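(* Let $B$ be a compact C$^*$-algebra, and let $\Omega$ be a compact Hausdorff space. Then every weak-2-local derivation $\Delta: C(\Omega,B)\to C(\Omega,B)$ is a (linear) derivation. In particular, every 2-local derivation on $C(\Omega,B)$ is a (linear) derivation.
   Context: A compact C$^*$-algebra is a C$^*$-algebra that is C$^*$-isomorphic to a $c_0$-sum $\left(\bigoplus_{i\in I}K(H_i)\right)_{c_0}$, where each $H_i$ is a complex Hilbert space and $K(H_i)$ is the C$^*$-algebra of compact linear operators on $H_i$. $C(\Omega,B)$ denotes the C$^*$-algebra of all continuous functions $\Omega\to B$ with pointwise operations and the sup norm. A derivation on a C$^*$-algebra $C$ is a linear map $D:C\to C$ with $D(ab)=D(a)b+aD(b)$ for all $a,b\in C$. A weak-2-local derivation on $C$ is a mapping $\Delta:C\to C$ (not assumed linear or continuous) such that for all $a,b\in C$ and every $\phi\in C^*$ there exists a derivation $D_{a,b,\phi}:C\to C$, depending on $a$, $b$ and $\phi$, with $\phi(\Delta(a))=\phi(D_{a,b,\phi}(a))$ and $\phi(\Delta(b))=\phi(D_{a,b,\phi}(b))$. A 2-local derivation on $C$ is a mapping $\Delta:C\to C$ (not assumed linear or continuous) such that for all $a,b\in C$ there exists a derivation $D_{a,b}:C\to C$, depending on $a$ and $b$, with $\Delta(a)=D_{a,b}(a)$ and $\Delta(b)=D_{a,b}(b)$. *)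

theory Defs
  imports "HOL-Analysis.Analysis"
begin

section \<open>C*-algebras\<close>

text \<open>No unit is required, and the zero algebra is allowed.\<close>

class cstar_algebra = real_normed_algebra + banach +
  fixes scaleC :: "complex \<Rightarrow> 'a \<Rightarrow> 'a"
    and star :: "'a \<Rightarrow> 'a"
  assumes scaleC_of_real: "scaleC (complex_of_real r) x = scaleR r x"
    and scaleC_add_right: "scaleC c (x + y) = scaleC c x + scaleC c y"
    and scaleC_add_left: "scaleC (c + d) x = scaleC c x + scaleC d x"
    and scaleC_scaleC: "scaleC c (scaleC d x) = scaleC (c * d) x"
    and norm_scaleC: "norm (scaleC c x) = cmod c * norm x"
    and scaleC_mult_left: "scaleC c x * y = scaleC c (x * y)"
    and scaleC_mult_right: "x * scaleC c y = scaleC c (x * y)"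
    and star_star: "star (star x) = x"
    and star_add: "star (x + y) = star x + star y"
    and star_scaleC: "star (scaleC c x) = scaleC (cnj c) (star x)"
    and star_mult: "star (x * y) = star y * star x"
    and norm_star_mult_self: "norm (star x * x) = (norm x)\<^sup>2"
begin

lemma norm_star: "norm (star x) = norm x"
proof -
  have le: "norm y \<le> norm (star y)" for y
  proof (cases "norm y = 0")
    case False
    have "norm y * norm y \<le> norm (star y) * norm y"
      using norm_star_mult_self[of y] norm_mult_ineq[of "star y" y]
      by (simp add: power2_eq_square)
    then show ?thesis
      using False by simp
  qed simp
  from le[of x] le[of "star x"] show ?thesis
    by (simp add: star_star)
qed

end

text \<open>The dual space \<open>C\<^sup>*\<close>.\<close>

definition cdual :: "('a::cstar_algebra \<Rightarrow> complex) set" where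
  "cdual = {\<phi>. bounded_linear \<phi> \<and> (\<forall>c x. \<phi> (scaleC c x) = c * \<phi> x)}"

section \<open>Derivations\<close>

definition derivation :: "('a::cstar_algebra \<Rightarrow> 'a) \<Rightarrow> bool" where
  "derivation D \<longleftrightarrow>
     (\<forall>a b. D (a + b) = D a + D b) \<and>
     (\<forall>c a. D (scaleC c a) = scaleC c (D a)) \<and>
     (\<forall>a b. D (a * b) = D a * b + a * D b)"

definition weak_2_local_derivation :: "('a::cstar_algebra \<Rightarrow> 'a) \<Rightarrow> bool" where
  "weak_2_local_derivation \<Delta> \<longleftrightarrow>
     (\<forall>a b. \<forall>\<phi>\<in>cdual. \<exists>D. derivation D \<and> \<phi> (\<Delta> a) = \<phi> (D a) \<and> \<phi> (\<Delta> b) = \<phi> (D b))"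

definition two_local_derivation :: "('a::cstar_algebra \<Rightarrow> 'a) \<Rightarrow> bool" where
  "two_local_derivation \<Delta> \<longleftrightarrow>
     (\<forall>a b. \<exists>D. derivation D \<and> \<Delta> a = D a \<and> \<Delta> b = D b)"

section \<open>The C*-algebra of bounded continuous functions\<close>

text \<open>On a compact space every continuous function into a normed space is bounded, so for compact
  \<open>'a\<close> the type \<open>'a \<Rightarrow>\<^sub>C 'b\<close> is the algebra of all continuous functions, with the supremum norm.
  The library provides completeness only for metric domains, hence the first instance.\<close>

instance bcontfun :: (topological_space, complete_space) complete_space
proof
  fix f :: "nat \<Rightarrow> 'a \<Rightarrow>\<^sub>C 'b"
  assume "Cauchy f"
  then obtain g where "uniform_limit UNIV (\<lambda>n. apply_bcontfun (f n)) g sequentially"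
    using uniformly_convergent_eq_cauchy[of "\<lambda>_. True" "\<lambda>n. apply_bcontfun (f n)"]
    unfolding Cauchy_def uniform_limit_sequentially_iff
    by (metis dist_fun_lt_imp_dist_val_lt)
  from uniform_limit_bcontfunE[OF this sequentially_bot]
  obtain l where "f \<longlonglongrightarrow> l"
    by metis
  then show "convergent f"
    by (intro convergentI)
qed

instance bcontfun :: (topological_space, banach) banach ..

lemma continuous_on_scaleC [continuous_intros]:
  fixes f :: "'a::topological_space \<Rightarrow> 'b::cstar_algebra"
  assumes "continuous_on S f"
  shows "continuous_on S (\<lambda>x. scaleC c (f x))"
proof -
  have "bounded_linear (scaleC c :: 'b \<Rightarrow> 'b)"
  proof (rule bounded_linear_intro)
    show "scaleC c (r *\<^sub>R x) = r *\<^sub>R scaleC c x" for r and x :: 'b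
      by (simp add: scaleC_of_real [symmetric] scaleC_scaleC mult.commute)
    show "norm (scaleC c x) \<le> norm x * cmod c" for x :: 'b
      by (simp add: norm_scaleC)
  qed (rule scaleC_add_right)
  then show ?thesis
    using assms by (rule bounded_linear.continuous_on)
qed

lemma continuous_on_star [continuous_intros]:
  fixes f :: "'a::topological_space \<Rightarrow> 'b::cstar_algebra"
  assumes "continuous_on S f"
  shows "continuous_on S (\<lambda>x. star (f x))"
proof -
  have "bounded_linear (star :: 'b \<Rightarrow> 'b)"
  proof (rule bounded_linear_intro)
    show "star (r *\<^sub>R x) = r *\<^sub>R star x" for r and x :: 'b
      by (simp add: scaleC_of_real [symmetric] star_scaleC)
    show "norm (star x) \<le> norm x * 1" for x :: 'b
      by (simp add: norm_star)
  qed (rule star_add)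
  then show ?thesis
    using assms by (rule bounded_linear.continuous_on)
qed

unbundle bcontfun.lifting

instantiation bcontfun :: (topological_space, cstar_algebra) cstar_algebra
begin

lift_definition times_bcontfun :: "('a \<Rightarrow>\<^sub>C 'b) \<Rightarrow> ('a \<Rightarrow>\<^sub>C 'b) \<Rightarrow> 'a \<Rightarrow>\<^sub>C 'b"
  is "\<lambda>f g x. f x * g x"
proof -
  fix f g :: "'a \<Rightarrow> 'b"
  assume f: "f \<in> bcontfun" and g: "g \<in> bcontfun"
  obtain F where F: "\<And>x. norm (f x) \<le> F"
    using f by (auto simp: bcontfun_def bounded_iff)
  obtain G where G: "\<And>x. norm (g x) \<le> G"
    using g by (auto simp: bcontfun_def bounded_iff)
  have "norm (f x * g x) \<le> F * G" for x
    using norm_mult_ineq[of "f x" "g x"] mult_mono'[OF F[of x] G[of x]] by simp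
  moreover have "continuous_on UNIV (\<lambda>x. f x * g x)"
    using f g by (auto simp: bcontfun_def intro!: continuous_intros)
  ultimately show "(\<lambda>x. f x * g x) \<in> bcontfun"
    by (intro bcontfun_normI)
qed

lift_definition scaleC_bcontfun :: "complex \<Rightarrow> ('a \<Rightarrow>\<^sub>C 'b) \<Rightarrow> 'a \<Rightarrow>\<^sub>C 'b"
  is "\<lambda>c f x. scaleC c (f x)"
proof -
  fix c and f :: "'a \<Rightarrow> 'b"
  assume f: "f \<in> bcontfun"
  obtain F where "\<And>x. norm (f x) \<le> F"
    using f by (auto simp: bcontfun_def bounded_iff)
  then have "norm (scaleC c (f x)) \<le> cmod c * F" for x
    by (simp add: norm_scaleC mult_left_mono)
  moreover have "continuous_on UNIV (\<lambda>x. scaleC c (f x))"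
    using f by (auto simp: bcontfun_def intro!: continuous_intros)
  ultimately show "(\<lambda>x. scaleC c (f x)) \<in> bcontfun"
    by (intro bcontfun_normI)
qed

lift_definition star_bcontfun :: "('a \<Rightarrow>\<^sub>C 'b) \<Rightarrow> 'a \<Rightarrow>\<^sub>C 'b"
  is "\<lambda>f x. star (f x)"
proof -
  fix f :: "'a \<Rightarrow> 'b"
  assume f: "f \<in> bcontfun"
  then show "(\<lambda>x. star (f x)) \<in> bcontfun"
    by (auto simp: bcontfun_def bounded_iff norm_star intro!: continuous_intros)
qed

instance
proof
  fix f g h :: "'a \<Rightarrow>\<^sub>C 'b" and c d :: complex and r :: real
  note rep = times_bcontfun.rep_eq scaleC_bcontfun.rep_eq star_bcontfun.rep_eq
  show "f * g * h = f * (g * h)"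
    by (rule bcontfun_eqI) (simp add: rep mult.assoc)
  show "(f + g) * h = f * h + g * h"
    by (rule bcontfun_eqI) (simp add: rep distrib_right)
  show "f * (g + h) = f * g + f * h"
    by (rule bcontfun_eqI) (simp add: rep distrib_left)
  show "r *\<^sub>R f * g = r *\<^sub>R (f * g)"
    by (rule bcontfun_eqI) (simp add: rep)
  show "f * r *\<^sub>R g = r *\<^sub>R (f * g)"
    by (rule bcontfun_eqI) (simp add: rep)
  have mult_le: "norm (f * g) \<le> norm f * norm g" for f g :: "'a \<Rightarrow>\<^sub>C 'b"
  proof (rule norm_bound)
    fix x
    have "norm (apply_bcontfun (f * g) x) \<le> norm (f x) * norm (g x)"
      by (simp add: rep norm_mult_ineq)
    also have "\<dots> \<le> norm f * norm g"
      by (intro mult_mono norm_bounded) auto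
    finally show "norm (apply_bcontfun (f * g) x) \<le> norm f * norm g" .
  qed
  then show "norm (f * g) \<le> norm f * norm g" .
  show "scaleC (complex_of_real r) f = r *\<^sub>R f"
    by (rule bcontfun_eqI) (simp add: rep scaleC_of_real)
  show "scaleC c (f + g) = scaleC c f + scaleC c g"
    by (rule bcontfun_eqI) (simp add: rep scaleC_add_right)
  show "scaleC (c + d) f = scaleC c f + scaleC d f"
    by (rule bcontfun_eqI) (simp add: rep scaleC_add_left)
  show scaleC_scaleC': "scaleC c (scaleC d f) = scaleC (c * d) f" for c d
    by (rule bcontfun_eqI) (simp add: rep scaleC_scaleC)
  have scaleC_le: "norm (scaleC c f) \<le> cmod c * norm f" for c and f :: "'a \<Rightarrow>\<^sub>C 'b"
    by (rule norm_bound) (simp add: rep norm_scaleC mult_left_mono norm_bounded)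
  show "norm (scaleC c f) = cmod c * norm f"
  proof (cases "c = 0")
    case True
    then show ?thesis
      using scaleC_le[of 0 f] by simp
  next
    case False
    have "scaleC (inverse c) (scaleC c f) = f"
      using False scaleC_of_real[where r = 1]
      by (intro bcontfun_eqI) (simp add: rep scaleC_scaleC)
    then have "norm f \<le> cmod (inverse c) * norm (scaleC c f)"
      using scaleC_le[of "inverse c" "scaleC c f"] by simp
    then have "cmod c * norm f \<le> norm (scaleC c f)"
      using False by (simp add: norm_divide field_simps)
    then show ?thesis
      using scaleC_le[of c f] by simp
  qed
  show "scaleC c f * g = scaleC c (f * g)"
    by (rule bcontfun_eqI) (simp add: rep scaleC_mult_left)
  show "f * scaleC c g = scaleC c (f * g)"
    by (rule bcontfun_eqI) (simp add: rep scaleC_mult_right)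
  show "star (star f) = f"
    by (rule bcontfun_eqI) (simp add: rep star_star)
  show "star (f + g) = star f + star g"
    by (rule bcontfun_eqI) (simp add: rep star_add)
  show "star (scaleC c f) = scaleC (cnj c) (star f)"
    by (rule bcontfun_eqI) (simp add: rep star_scaleC)
  show "star (f * g) = star g * star f"
    by (rule bcontfun_eqI) (simp add: rep star_mult)
  show "norm (star f * f) = (norm f)\<^sup>2"
  proof (rule antisym)
    have "norm (star f) \<le> norm f"
      by (rule norm_bound) (simp add: rep norm_star norm_bounded)
    then show "norm (star f * f) \<le> (norm f)\<^sup>2"
      using mult_le[of "star f" f] mult_right_mono[of "norm (star f)" "norm f" "norm f"]
      by (simp add: power2_eq_square)
    have "norm f \<le> sqrt (norm (star f * f))"
    proof (rule norm_bound)
      fix x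
      have "(norm (f x))\<^sup>2 \<le> norm (star f * f)"
        using norm_bounded[of "star f * f" x] by (simp add: rep norm_star_mult_self)
      then show "norm (f x) \<le> sqrt (norm (star f * f))"
        by (rule real_le_rsqrt)
    qed
    then show "(norm f)\<^sup>2 \<le> norm (star f * f)"
      using power_mono[of "norm f" "sqrt (norm (star f * f))" 2] by simp
  qed
qed

end

lifting_update bcontfun.lifting
lifting_forget bcontfun.lifting

section \<open>Complex Hilbert spaces and compact operators\<close>

text \<open>The summands of a \<open>c\<^sub>0\<close>-sum live on different Hilbert spaces, so these cannot be types.
  They are given by a carrier set together with its operations.\<close>

record 'h hilbert_structure =
  hcarrier :: "'h set"
  hzero :: 'h
  hadd :: "'h \<Rightarrow> 'h \<Rightarrow> 'h"
  hscale :: "complex \<Rightarrow> 'h \<Rightarrow> 'h"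
  hinner :: "'h \<Rightarrow> 'h \<Rightarrow> complex"

definition hnorm :: "'h hilbert_structure \<Rightarrow> 'h \<Rightarrow> real" where
  "hnorm H x = sqrt (Re (hinner H x x))"

definition hdist :: "'h hilbert_structure \<Rightarrow> 'h \<Rightarrow> 'h \<Rightarrow> real" where
  "hdist H x y = hnorm H (hadd H x (hscale H (- 1) y))"

definition htopology :: "'h hilbert_structure \<Rightarrow> 'h topology" where
  "htopology H = Metric_space.mtopology (hcarrier H) (hdist H)"

text \<open>The inner product is linear in its first argument.\<close>

locale complex_hilbert_space =
  fixes H :: "'h hilbert_structure"
  assumes zero_closed: "hzero H \<in> hcarrier H"
    and add_closed: "\<lbrakk>x \<in> hcarrier H; y \<in> hcarrier H\<rbrakk> \<Longrightarrow> hadd H x y \<in> hcarrier H"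
    and scale_closed: "x \<in> hcarrier H \<Longrightarrow> hscale H c x \<in> hcarrier H"
    and add_assoc: "\<lbrakk>x \<in> hcarrier H; y \<in> hcarrier H; z \<in> hcarrier H\<rbrakk>
          \<Longrightarrow> hadd H (hadd H x y) z = hadd H x (hadd H y z)"
    and add_commute: "\<lbrakk>x \<in> hcarrier H; y \<in> hcarrier H\<rbrakk> \<Longrightarrow> hadd H x y = hadd H y x"
    and add_zero: "x \<in> hcarrier H \<Longrightarrow> hadd H (hzero H) x = x"
    and add_neg: "x \<in> hcarrier H \<Longrightarrow> hadd H x (hscale H (- 1) x) = hzero H"
    and scale_add_right: "\<lbrakk>x \<in> hcarrier H; y \<in> hcarrier H\<rbrakk>
          \<Longrightarrow> hscale H c (hadd H x y) = hadd H (hscale H c x) (hscale H c y)"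
    and scale_add_left: "x \<in> hcarrier H
          \<Longrightarrow> hscale H (c + d) x = hadd H (hscale H c x) (hscale H d x)"
    and scale_scale: "x \<in> hcarrier H \<Longrightarrow> hscale H c (hscale H d x) = hscale H (c * d) x"
    and scale_one: "x \<in> hcarrier H \<Longrightarrow> hscale H 1 x = x"
    and inner_commute: "\<lbrakk>x \<in> hcarrier H; y \<in> hcarrier H\<rbrakk>
          \<Longrightarrow> hinner H y x = cnj (hinner H x y)"
    and inner_add_left: "\<lbrakk>x \<in> hcarrier H; y \<in> hcarrier H; z \<in> hcarrier H\<rbrakk>
          \<Longrightarrow> hinner H (hadd H x y) z = hinner H x z + hinner H y z"
    and inner_scale_left: "\<lbrakk>x \<in> hcarrier H; y \<in> hcarrier H\<rbrakk>
          \<Longrightarrow> hinner H (hscale H c x) y = c * hinner H x y"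
    and inner_nonneg: "x \<in> hcarrier H \<Longrightarrow> 0 \<le> Re (hinner H x x)"
    and inner_eq_zero: "\<lbrakk>x \<in> hcarrier H; hinner H x x = 0\<rbrakk> \<Longrightarrow> x = hzero H"
    and complete: "Metric_space.mcomplete (hcarrier H) (hdist H)"

definition hunit_ball :: "'h hilbert_structure \<Rightarrow> 'h set" where
  "hunit_ball H = {x \<in> hcarrier H. hnorm H x \<le> 1}"

text \<open>\<open>K(H)\<close>: the linear operators mapping the unit ball to a relatively compact set. Operators
  are extensional functions on the carrier, so that equality of operators is equality of
  functions.\<close>

definition compact_operators :: "'h hilbert_structure \<Rightarrow> ('h \<Rightarrow> 'h) set" where
  "compact_operators H =
     {T \<in> hcarrier H \<rightarrow>\<^sub>E hcarrier H.
        (\<forall>x\<in>hcarrier H. \<forall>y\<in>hcarrier H. T (hadd H x y) = hadd H (T x) (T y)) \<and>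
        (\<forall>c. \<forall>x\<in>hcarrier H. T (hscale H c x) = hscale H c (T x)) \<and>
        compactin (htopology H) (htopology H closure_of (T ` hunit_ball H))}"

definition op_norm :: "'h hilbert_structure \<Rightarrow> ('h \<Rightarrow> 'h) \<Rightarrow> real" where
  "op_norm H T = (SUP x\<in>hunit_ball H. hnorm H (T x))"

definition op_add :: "'h hilbert_structure \<Rightarrow> ('h \<Rightarrow> 'h) \<Rightarrow> ('h \<Rightarrow> 'h) \<Rightarrow> 'h \<Rightarrow> 'h" where
  "op_add H S T = (\<lambda>x\<in>hcarrier H. hadd H (S x) (T x))"

definition op_scale :: "'h hilbert_structure \<Rightarrow> complex \<Rightarrow> ('h \<Rightarrow> 'h) \<Rightarrow> 'h \<Rightarrow> 'h" where
  "op_scale H c T = (\<lambda>x\<in>hcarrier H. hscale H c (T x))"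

text \<open>For \<open>S, T \<in> K(H)\<close> this says \<open>S = T\<^sup>*\<close>, since the adjoint is determined by this identity.\<close>

definition is_adjoint :: "'h hilbert_structure \<Rightarrow> ('h \<Rightarrow> 'h) \<Rightarrow> ('h \<Rightarrow> 'h) \<Rightarrow> bool" where
  "is_adjoint H T S \<longleftrightarrow>
     (\<forall>x\<in>hcarrier H. \<forall>y\<in>hcarrier H. hinner H (T x) y = hinner H x (S y))"

section \<open>Compact C*-algebras\<close>

text \<open>The \<open>c\<^sub>0\<close>-sum of the \<open>K(H\<^sub>i)\<close>: families whose norms vanish at infinity on the discrete
  set \<open>I\<close>.\<close>

definition c0_sum_compact_operators ::
    "'i set \<Rightarrow> ('i \<Rightarrow> 'h hilbert_structure) \<Rightarrow> ('i \<Rightarrow> 'h \<Rightarrow> 'h) set" where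
  "c0_sum_compact_operators I H =
     {T \<in> (\<Pi>\<^sub>E i\<in>I. compact_operators (H i)).
        \<forall>\<epsilon>>0. finite {i \<in> I. \<epsilon> \<le> op_norm (H i) (T i)}}"

text \<open>C*-isomorphisms (bijective *-homomorphisms) onto the \<open>c\<^sub>0\<close>-sum with its coordinatewise
  operations. Such a map is automatically isometric, so this is not demanded.\<close>

definition cstar_isomorphism_c0_sum ::
    "'i set \<Rightarrow> ('i \<Rightarrow> 'h hilbert_structure) \<Rightarrow> ('b::cstar_algebra \<Rightarrow> 'i \<Rightarrow> 'h \<Rightarrow> 'h) \<Rightarrow> bool" where
  "cstar_isomorphism_c0_sum I H \<Phi> \<longleftrightarrow>
     bij_betw \<Phi> UNIV (c0_sum_compact_operators I H) \<and>
     (\<forall>a b. \<forall>i\<in>I. \<Phi> (a + b) i = op_add (H i) (\<Phi> a i) (\<Phi> b i)) \<and>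
     (\<forall>c a. \<forall>i\<in>I. \<Phi> (scaleC c a) i = op_scale (H i) c (\<Phi> a i)) \<and>
     (\<forall>a b. \<forall>i\<in>I. \<Phi> (a * b) i = compose (hcarrier (H i)) (\<Phi> a i) (\<Phi> b i)) \<and>
     (\<forall>a. \<forall>i\<in>I. is_adjoint (H i) (\<Phi> a i) (\<Phi> (star a) i))"

text \<open>One cannot quantify over types, so the types \<open>'i\<close> of the indices and \<open>'h\<close> of the vectors are
  parameters. A statement with this hypothesis and free \<open>'i\<close> and \<open>'h\<close> covers all families, as any
  family of Hilbert spaces can be placed in a common type.\<close>

definition compact_cstar_algebra ::
    "'b::cstar_algebra itself \<Rightarrow> 'i itself \<Rightarrow> 'h itself \<Rightarrow> bool" where
  "compact_cstar_algebra _ _ _ \<longleftrightarrow>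
     (\<exists>(I :: 'i set) (H :: 'i \<Rightarrow> 'h hilbert_structure) (\<Phi> :: 'b \<Rightarrow> 'i \<Rightarrow> 'h \<Rightarrow> 'h).
        (\<forall>i\<in>I. complex_hilbert_space (H i)) \<and> cstar_isomorphism_c0_sum I H \<Phi>)"

end

theory Submission
  imports Defs
begin

text \<open>Let \<open>e\<close> be a minimal projection of \<open>B\<close> and \<open>\<xi>, \<eta> \<in> B e\<close>. A derivation \<open>D\<close> of \<open>C(\<Omega>, B)\<close> satisfies
  \<open>D(c)(w) \<xi> = W(c(w) \<xi>) - c(w) W(\<xi>)\<close> with \<open>W\<close> linear, so a functional given by an element of finite
  rank at \<open>w\<close> kills \<open>D(c)\<close> whenever that element commutes with \<open>c(w)\<close>. Hence a weak-2-local
  derivation \<open>\<Delta>\<close> induces a homogeneous map \<open>\<delta>\<close> on each fibre, and for \<open>F\<close> of finite rank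
  \<open>tr (F \<delta>(x))\<close> depends only on the class of \<open>x\<close> modulo the commutant of \<open>F\<close>.

  For rank-one \<open>F\<close> and \<open>G\<close>, the element \<open>F + G\<close> commutes with itself, which gives
  \<open>tr (F (\<delta>(x + G) - \<delta>(x))) = tr (G (\<delta>(x) - \<delta>(x + F)))\<close>. The right-hand side does not change when \<open>G\<close> is
  added to \<open>x\<close>, so \<open>x \<mapsto> tr (F \<delta>(x))\<close> satisfies Jensen's equation in every rank-one direction; with
  homogeneity, \<open>\<delta>\<close> is additive. Once \<open>\<delta>\<close> is linear, the Leibniz rule holds for pairs of idempotents,
  hence for elements of rank one, and it extends to \<open>B\<close> because each coefficient
  \<open>star \<eta> * \<delta> x * \<xi>\<close> only depends on \<open>x * \<xi>\<close> and \<open>star \<eta> * x\<close>.\<close>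

section \<open>Elementary rules for scalars, the involution and derivations\<close>

lemma scaleC_zero_right [simp]: "scaleC c (0::'a::cstar_algebra) = 0"
  using scaleC_add_right[of c "0::'a" 0] by simp

lemma scaleC_zero_left [simp]: "scaleC 0 (x::'a::cstar_algebra) = 0"
  using scaleC_add_left[of 0 0 x] by simp

lemma scaleC_one [simp]: "scaleC 1 (x::'a::cstar_algebra) = x"
  using scaleC_of_real[of 1 x] by simp

lemma scaleC_minus_right: "scaleC c (- x) = - scaleC c (x::'a::cstar_algebra)"
  using scaleC_add_right[of c x "- x"] by (simp add: minus_unique)

lemma scaleC_diff_right: "scaleC c (x - y) = scaleC c x - scaleC c (y::'a::cstar_algebra)"
  using scaleC_add_right[of c x "- y"] by (simp add: scaleC_minus_right)

lemma scaleC_eq_0_iff: "scaleC c x = 0 \<longleftrightarrow> c = 0 \<or> (x::'a::cstar_algebra) = 0"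
  by (metis norm_eq_zero norm_scaleC mult_eq_0_iff)

lemma scaleC_cancel_right: "x \<noteq> 0 \<Longrightarrow> scaleC c x = scaleC d x \<longleftrightarrow> c = (d::complex)" for x :: "'a::cstar_algebra"
  by (metis add_diff_cancel_left' diff_add_cancel scaleC_add_left scaleC_eq_0_iff add_cancel_right_right)

lemma star_zero [simp]: "star (0::'a::cstar_algebra) = 0"
  using star_add[of "0::'a" 0] by simp

lemma star_diff: "star (x - y) = star x - star (y::'a::cstar_algebra)"
  using star_add[of "x - y" y] by simp

lemma star_mult_self_eq_0_iff: "star x * x = 0 \<longleftrightarrow> (x::'a::cstar_algebra) = 0"
  using norm_star_mult_self[of x] by auto

lemma derivationD:
  assumes "derivation D"
  shows "D (a + b) = D a + D b" "D (scaleC c a) = scaleC c (D a)" "D (a * b) = D a * b + a * D b"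
    "D 0 = 0" "D (a - b) = D a - D b"
proof -
  show add: "D (a + b) = D a + D b" "D (scaleC c a) = scaleC c (D a)" "D (a * b) = D a * b + a * D b" for a b c
    using assms by (auto simp: derivation_def)
  show "D 0 = 0"
    using add(2)[of 0 0] by simp
  show "D (a - b) = D a - D b"
    using add(1)[of "a - b" b] by simp
qed

section \<open>Minimal projections and rank-one elements\<close>

text \<open>For a minimal projection \<open>e\<close>, the elements \<open>\<xi>\<close> with \<open>\<xi> * e = \<xi>\<close> play the role of vectors:
  \<open>star \<eta> * \<xi>\<close> is the inner product times \<open>e\<close>, and \<open>\<xi> * star \<eta>\<close> is the rank-one operator.\<close>

definition minimal_projection :: "'a::cstar_algebra \<Rightarrow> bool" where
  "minimal_projection e \<longleftrightarrow>
     e \<noteq> 0 \<and> star e = e \<and> e * e = e \<and> (\<forall>b. \<exists>c. e * b * e = scaleC c e)"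

text \<open>The product lies in the corner \<open>e * b * e\<close>, which minimality makes
  one-dimensional.\<close>

lemma minimal_projection_inner:
  assumes "minimal_projection e" "\<xi> * e = \<xi>" "\<eta> * e = \<eta>"
  obtains c where "star \<eta> * \<xi> = scaleC c e"
proof -
  have "star \<eta> = e * star \<eta>"
    using assms by (metis star_mult minimal_projection_def)
  then have "star \<eta> * \<xi> = e * (star \<eta> * \<xi>) * e"
    using assms(2) by (metis mult.assoc)
  with assms(1) that show ?thesis
    by (metis minimal_projection_def)
qed

text \<open>The only consequence of being a compact C*-algebra on which the derivation arguments
  rest; it keeps them free of Hilbert spaces.\<close>

definition separated_by_minimal_projections :: "'a::cstar_algebra itself \<Rightarrow> bool" where
  "separated_by_minimal_projections _ \<longleftrightarrow>
     (\<forall>b::'a. b \<noteq> 0 \<longrightarrow> (\<exists>e. minimal_projection e \<and> b * e \<noteq> 0))"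

lemma separated_eqI:
  fixes a b :: "'a::cstar_algebra"
  assumes "separated_by_minimal_projections TYPE('a)"
    and eq: "\<And>e \<xi> \<eta>. \<lbrakk>minimal_projection e; \<xi> * e = \<xi>; \<eta> * e = \<eta>\<rbrakk>
      \<Longrightarrow> star \<eta> * a * \<xi> = star \<eta> * b * \<xi>"
  shows "a = b"
proof (rule ccontr)
  assume "a \<noteq> b"
  then obtain e where e: "minimal_projection e" "(a - b) * e \<noteq> 0"
    using assms(1) unfolding separated_by_minimal_projections_def by (metis right_minus_eq)
  then have ee: "e * e = e"
    by (simp add: minimal_projection_def)
  \<comment> \<open>Tested against \<open>\<xi> = e\<close> and this vector, the difference
    \<open>a - b\<close> yields \<open>star ?\<eta> * ?\<eta>\<close>, which vanishes only for
    \<open>?\<eta> = 0\<close> by the C*-identity.\<close>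
  let ?\<eta> = "(a - b) * e"
  have "star ?\<eta> * a * e = star ?\<eta> * b * e"
    by (rule eq[OF e(1)]) (simp_all add: ee mult.assoc)
  then have "star ?\<eta> * ?\<eta> = 0"
    by (simp add: algebra_simps)
  with e(2) show False
    by (simp add: star_mult_self_eq_0_iff)
qed

text \<open>For \<open>\<xi> = 0\<close> this is \<open>0\<close>, since \<open>1 / 0 = 0\<close>.\<close>

definition range_projection :: "'a::cstar_algebra \<Rightarrow> 'a \<Rightarrow> 'a" where
  "range_projection e \<xi> = scaleC (1 / (THE c. star \<xi> * \<xi> = scaleC c e)) (\<xi> * star \<xi>)"

lemma range_projection:
  assumes e: "minimal_projection e" and \<xi>: "\<xi> * e = \<xi>"
  shows "range_projection e \<xi> * \<xi> = \<xi>"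
    "star \<xi> * range_projection e \<xi> = star \<xi>"
proof -
  obtain c where c: "star \<xi> * \<xi> = scaleC c e"
    using minimal_projection_inner[OF e \<xi> \<xi>] .
  have e0: "e \<noteq> 0" and \<xi>': "e * star \<xi> = star \<xi>"
    using e \<xi> by (metis minimal_projection_def star_mult)+
  have the: "(THE c. star \<xi> * \<xi> = scaleC c e) = c"
    using c scaleC_cancel_right[OF e0] by auto
  have P: "range_projection e \<xi> = scaleC (1 / c) (\<xi> * star \<xi>)"
    by (simp only: range_projection_def the)
  have c0: "c \<noteq> 0" if "\<xi> \<noteq> 0"
    using that c star_mult_self_eq_0_iff[of \<xi>] by auto
  show "range_projection e \<xi> * \<xi> = \<xi>"
    using c0 by (cases "\<xi> = 0")
      (simp_all add: P scaleC_mult_left scaleC_mult_right mult.assoc c \<xi> scaleC_scaleC)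
  show "star \<xi> * range_projection e \<xi> = star \<xi>"
    using c0 by (cases "\<xi> = 0")
      (simp_all add: P scaleC_mult_left scaleC_mult_right mult.assoc[symmetric] c \<xi>' scaleC_scaleC)
qed

text \<open>With range projections \<open>P\<close> of \<xi> and \<open>Q\<close> of \<eta>, the
  element is \<open>x * P + Q * (x - x * P)\<close>. The second summand dies on \<xi>, and
  \<open>star \<eta>\<close> absorbs \<open>Q\<close>.\<close>

lemma rank_two_approximation:
  assumes e: "minimal_projection e" and \<xi>: "\<xi> * e = \<xi>" and \<eta>: "\<eta> * e = \<eta>"
  obtains \<alpha> \<beta> where "\<alpha> * e = \<alpha>" "\<beta> * e = \<beta>"
    "(\<alpha> * star \<xi> + \<eta> * star \<beta>) * \<xi> = x * \<xi>"
    "star \<eta> * (\<alpha> * star \<xi> + \<eta> * star \<beta>) = star \<eta> * x"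
proof -
  let ?P = "range_projection e \<xi>" and ?Q = "range_projection e \<eta>"
  let ?w = "x - x * ?P"
  obtain k l where k: "?P = scaleC k (\<xi> * star \<xi>)" and l: "?Q = scaleC l (\<eta> * star \<eta>)"
    by (auto simp: range_projection_def)
  have eq: "scaleC k (x * \<xi>) * star \<xi> + \<eta> * star (scaleC (cnj l) (star ?w * \<eta>)) = x * ?P + ?Q * ?w"
    unfolding k l by (simp add: scaleC_mult_left scaleC_mult_right star_scaleC star_mult star_star mult.assoc)
  show ?thesis
  proof (rule that)
    show "scaleC k (x * \<xi>) * e = scaleC k (x * \<xi>)"
      by (simp add: scaleC_mult_left mult.assoc \<xi>)
    show "scaleC (cnj l) (star ?w * \<eta>) * e = scaleC (cnj l) (star ?w * \<eta>)"
      by (simp add: scaleC_mult_left mult.assoc \<eta>)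
    show "(scaleC k (x * \<xi>) * star \<xi> + \<eta> * star (scaleC (cnj l) (star ?w * \<eta>))) * \<xi> = x * \<xi>"
      unfolding eq by (simp add: distrib_right left_diff_distrib mult.assoc range_projection[OF e \<xi>])
    show "star \<eta> * (scaleC k (x * \<xi>) * star \<xi> + \<eta> * star (scaleC (cnj l) (star ?w * \<eta>))) = star \<eta> * x"
      unfolding eq
      by (simp add: distrib_left right_diff_distrib mult.assoc[symmetric] range_projection[OF e \<eta>])
  qed
qed

lemma rank_one_idempotent:
  assumes \<alpha>: "\<alpha> * e = \<alpha>" and c: "star \<beta> * \<alpha> = scaleC c e" "c \<noteq> 0"
  defines "p \<equiv> scaleC (1 / c) (\<alpha> * star \<beta>)"
  shows "p * p = p" "\<alpha> * star \<beta> = scaleC c p"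
proof -
  have "\<alpha> * star \<beta> * (\<alpha> * star \<beta>) = \<alpha> * (star \<beta> * \<alpha>) * star \<beta>"
    by (simp add: mult.assoc)
  also have "\<dots> = scaleC c (\<alpha> * star \<beta>)"
    by (simp add: c scaleC_mult_left scaleC_mult_right \<alpha>)
  finally show "p * p = p" "\<alpha> * star \<beta> = scaleC c p"
    using c(2) by (simp_all add: p_def scaleC_mult_left scaleC_mult_right scaleC_scaleC)
qed

lemma rank_one_eq_diff_idempotents:
  assumes e: "minimal_projection e" and \<alpha>: "\<alpha> * e = \<alpha>" and \<beta>: "\<beta> * e = \<beta>"
  obtains c d p q where "p * p = p" "q * q = q" "\<alpha> * star \<beta> = scaleC c p - scaleC d q"
proof -
  obtain k where k: "star \<beta> * \<alpha> = scaleC k e"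
    using minimal_projection_inner[OF e \<alpha> \<beta>] .
  obtain m where m: "star \<beta> * \<beta> = scaleC m e"
    using minimal_projection_inner[OF e \<beta> \<beta>] .
  consider "k \<noteq> 0" | "\<beta> = 0" | "k = 0" "m \<noteq> 0"
    using m star_mult_self_eq_0_iff[of \<beta>] by fastforce
  then show ?thesis
  proof cases
    case 1
    from rank_one_idempotent[OF \<alpha> k 1] show ?thesis
      by (intro that[of _ 0 _ 0]) auto
  next
    case 2
    then show ?thesis
      by (intro that[of 0 0 0 0]) auto
  next
    \<comment> \<open>Here the rank-one element is nilpotent. Adding
      \<open>\<beta> * star \<beta>\<close> makes it a nonzero multiple of an idempotent, and so is
      \<open>\<beta> * star \<beta>\<close> itself.\<close>
    case 3
    have "(\<alpha> + \<beta>) * e = \<alpha> + \<beta>" "star \<beta> * (\<alpha> + \<beta>) = scaleC m e"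
      using 3 by (simp_all add: distrib_right distrib_left \<alpha> \<beta> k m)
    from rank_one_idempotent[OF this 3(2)] rank_one_idempotent[OF \<beta> m 3(2)]
    show ?thesis
      by (intro that[of "scaleC (1 / m) ((\<alpha> + \<beta>) * star \<beta>)" "scaleC (1 / m) (\<beta> * star \<beta>)" m m])
        (auto simp: distrib_right simp flip: scaleC_diff_right)
  qed
qed

section \<open>The fibrewise problem\<close>

text \<open>The pairs \<open>x + y\<close>, \<open>x + z\<close> and \<open>x\<close>,
  \<open>x + y + z\<close> have the same midpoint \<open>x + (y + z) / 2\<close>. Jensen's equation
  is applied to each pair, with half-steps that stay in \<open>S\<close>.\<close>

lemma Jensen_imp_additive:
  fixes f :: "'v::real_vector \<Rightarrow> 'w::real_vector"
  assumes jensen: "\<And>x y. y \<in> S \<Longrightarrow> f (x + (y + y)) + f x = f (x + y) + f (x + y)"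
    and S: "subspace S" and "y \<in> S" "z \<in> S"
  shows "f (x + y + z) = f (x + y) + f (x + z) - f x"
proof -
  let ?h = "\<lambda>v. (1/2) *\<^sub>R v"
  have half: "?h v + ?h v = v" for v :: 'v
    by (metis scaleR_half_double scaleR_add_right)
  have in_S: "?h (z - y) \<in> S" "?h (y + z) \<in> S"
    using S assms(3,4) by (auto intro!: subspace_scale subspace_add subspace_diff)
  have mid: "x + y + ?h (z - y) = x + ?h (y + z)"
  proof -
    have "y = ?h y + ?h y" by (simp only: half)
    then show ?thesis by (simp add: algebra_simps)
  qed
  have "f (x + z) + f (x + y) = f (x + ?h (y + z)) + f (x + ?h (y + z))"
    using jensen[OF in_S(1), of "x + y"] by (simp only: half mid) simp
  also have "\<dots> = f (x + (y + z)) + f x"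
    using jensen[OF in_S(2), of x] by (simp only: half)
  finally show ?thesis
    by (simp add: algebra_simps)
qed

text \<open>Jensen's equation makes \<open>f (u + v)\<close> affine in \<open>u\<close> and in
  \<open>v\<close> separately, which leaves room for a bilinear cross term. Comparing
  \<open>f (2 u + 2 v)\<close> with \<open>2 f (u + v)\<close> removes that term.\<close>

lemma Jensen_two_subspaces:
  fixes f :: "'v::real_vector \<Rightarrow> 'w::real_vector"
  assumes jensen: "\<And>x y. y \<in> S \<union> T \<Longrightarrow> f (x + (y + y)) + f x = f (x + y) + f (x + y)"
    and S: "subspace S" and T: "subspace T"
    and double: "\<And>x. f (x + x) = f x + f x"
    and mem: "s \<in> S" "s' \<in> S" "t \<in> T" "t' \<in> T"
  shows "f ((s + s') + (t + t')) = f (s + t) + f (s' + t')"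
proof -
  have addS: "f (x + y + z) = f (x + y) + f (x + z) - f x" if "y \<in> S" "z \<in> S" for x y z
    using Jensen_imp_additive[OF _ S that] jensen by blast
  have addT: "f (x + y + z) = f (x + y) + f (x + z) - f x" if "y \<in> T" "z \<in> T" for x y z
    using Jensen_imp_additive[OF _ T that] jensen by blast
  have f0: "f 0 = 0"
    using double[of 0] by simp
  have split: "f (u + v) = f u + f v" if u: "u \<in> S" and v: "v \<in> T" for u v
  proof -
    have uv: "f (u + u + v) = f (u + v) + f (u + v) - f v"
      using addS[OF u u, of v] by (simp add: add.commute add.left_commute)
    have u0: "f (u + u + v + v) = f (u + u + v) + f (u + u + v) - f (u + u)"
      by (rule addT[OF v v])
    have "f (u + u + v + v) = f (u + v) + f (u + v)"
      using double[of "u + v"] by (simp add: add.commute add.left_commute)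
    then have "f (u + v) + f (u + v) =
        (f (u + v) + f (u + v) - f v) + (f (u + v) + f (u + v) - f v) - (f u + f u)"
      unfolding u0 uv double[of u] by (rule sym)
    then have "2 *\<^sub>R (f (u + v)) = 2 *\<^sub>R (f u + f v)"
      by (simp add: scaleR_2 algebra_simps)
    then show ?thesis by simp
  qed
  have "f (s + s') = f s + f s'" "f (t + t') = f t + f t'"
    using addS[OF mem(1,2), of 0] addT[OF mem(3,4), of 0] f0 by simp_all
  then show ?thesis
    using split mem subspace_add[OF S mem(1,2)] subspace_add[OF T mem(3,4)] by simp
qed

text \<open>The assumption \<open>one\<close> is invariance under differences that commute with
  \<open>\<xi> * star \<eta>\<close>, where \<open>c\<close> is the common eigenvalue on both sides.
  The assumption \<open>two\<close> is the case of a sum of two rank-one elements commuting with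
  itself.\<close>

context
  fixes \<delta> :: "'b::cstar_algebra \<Rightarrow> 'b"
  assumes sep: "separated_by_minimal_projections TYPE('b)"
    and hom: "\<And>c x. \<delta> (scaleC c x) = scaleC c (\<delta> x)"
    and one: "\<And>e \<xi> \<eta> c x y. \<lbrakk>minimal_projection e; \<xi> * e = \<xi>; \<eta> * e = \<eta>;
        (x - y) * \<xi> = scaleC c \<xi>; star \<eta> * (x - y) = scaleC c (star \<eta>)\<rbrakk>
        \<Longrightarrow> star \<eta> * \<delta> x * \<xi> = star \<eta> * \<delta> y * \<xi>"
    and two: "\<And>e \<xi> \<eta> \<alpha> \<beta> x y. \<lbrakk>minimal_projection e; \<xi> * e = \<xi>; \<eta> * e = \<eta>; \<alpha> * e = \<alpha>; \<beta> * e = \<beta>;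
        x - y = \<xi> * star \<eta> + \<alpha> * star \<beta>\<rbrakk>
        \<Longrightarrow> star \<eta> * \<delta> x * \<xi> + star \<beta> * \<delta> x * \<alpha> = star \<eta> * \<delta> y * \<xi> + star \<beta> * \<delta> y * \<alpha>"
begin

lemma rank_one_invariant:
  assumes e: "minimal_projection e" and \<xi>: "\<xi> * e = \<xi>" and \<eta>: "\<eta> * e = \<eta>"
  shows "star \<eta> * \<delta> (x + \<xi> * star \<eta>) * \<xi> = star \<eta> * \<delta> x * \<xi>"
proof -
  obtain c where c: "star \<eta> * \<xi> = scaleC c e"
    using minimal_projection_inner[OF e \<xi> \<eta>] .
  have \<eta>': "e * star \<eta> = star \<eta>"
    using e \<eta> by (metis star_mult minimal_projection_def)
  show ?thesis
  proof (rule one[OF e \<xi> \<eta>])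
    show "(x + \<xi> * star \<eta> - x) * \<xi> = scaleC c \<xi>"
      by (simp add: mult.assoc c scaleC_mult_right \<xi>)
    show "star \<eta> * (x + \<xi> * star \<eta> - x) = scaleC c (star \<eta>)"
      by (simp add: mult.assoc[symmetric] c scaleC_mult_left \<eta>')
  qed
qed

lemma rank_one_Jensen:
  assumes e: "minimal_projection e" and \<xi>: "\<xi> * e = \<xi>" and \<eta>: "\<eta> * e = \<eta>"
    and \<alpha>: "\<alpha> * e = \<alpha>" and \<beta>: "\<beta> * e = \<beta>"
  defines "f \<equiv> \<lambda>x. star \<eta> * \<delta> x * \<xi>" and "g \<equiv> \<alpha> * star \<beta>"
  shows "f (x + (g + g)) + f x = f (x + g) + f (x + g)"
proof -
  let ?h = "\<xi> * star \<eta>"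
  \<comment> \<open>Stated for every \<open>x\<close>, because it is used both at \<open>x\<close>
    and at \<open>x + g\<close>.\<close>
  have swap: "f (x + g) - f x = star \<beta> * \<delta> x * \<alpha> - star \<beta> * \<delta> (x + ?h) * \<alpha>" for x
  proof -
    have "f (x + g + ?h) + star \<beta> * \<delta> (x + ?h + g) * \<alpha> = f x + star \<beta> * \<delta> x * \<alpha>"
      using two[OF e \<xi> \<eta> \<alpha> \<beta>, of "x + g + ?h" x]
      by (simp add: f_def g_def algebra_simps)
    moreover have "f (x + g + ?h) = f (x + g)"
      unfolding f_def by (rule rank_one_invariant[OF e \<xi> \<eta>])
    moreover have "star \<beta> * \<delta> (x + ?h + g) * \<alpha> = star \<beta> * \<delta> (x + ?h) * \<alpha>"
      unfolding g_def by (rule rank_one_invariant[OF e \<alpha> \<beta>])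
    ultimately show ?thesis
      by (simp add: algebra_simps)
  qed
  have "f (x + g + g) - f (x + g) = star \<beta> * \<delta> (x + g) * \<alpha> - star \<beta> * \<delta> (x + ?h + g) * \<alpha>"
    using swap[of "x + g"] by (simp add: ac_simps)
  also have "\<dots> = f (x + g) - f x"
    using swap[of x] by (simp only: g_def rank_one_invariant[OF e \<alpha> \<beta>])
  finally show ?thesis
    by (simp add: algebra_simps)
qed

text \<open>The coefficient \<open>f z\<close> only sees \<open>z * \<xi>\<close> and
  \<open>star \<eta> * z\<close>, so \<open>z\<close> may be replaced by an element of
  \<open>S + T\<close>. Fixing \<xi> on the right or \<eta> on the left makes \<open>S\<close> and
  \<open>T\<close> linear spaces consisting of rank-one elements, so Jensen's equation holds along
  all of each.\<close>

lemma local_map_add: "\<delta> (x + y) = \<delta> x + \<delta> y"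
proof (rule separated_eqI[OF sep])
  fix e \<xi> \<eta> :: 'b
  assume e: "minimal_projection e" and \<xi>: "\<xi> * e = \<xi>" and \<eta>: "\<eta> * e = \<eta>"
  define f where "f = (\<lambda>z. star \<eta> * \<delta> z * \<xi>)"
  define S where "S = {\<alpha> * star \<xi> | \<alpha>. \<alpha> * e = \<alpha>}"
  define T where "T = {\<eta> * star \<beta> | \<beta>. \<beta> * e = \<beta>}"
  have zero: "0 \<in> S" "0 \<in> T"
    unfolding S_def T_def by (force intro: exI[of _ 0])+
  have add: "s + s' \<in> S" if "s \<in> S" "s' \<in> S" for s s'
    using that unfolding S_def by (auto simp flip: distrib_right) (metis distrib_right)
  have S: "subspace S"
    unfolding subspace_def using zero add
    by (auto simp: S_def simp flip: mult_scaleR_left) (metis mult_scaleR_left)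
  have addT: "s + s' \<in> T" if "s \<in> T" "s' \<in> T" for s s'
    using that unfolding T_def
    by (auto simp flip: distrib_left star_add) (metis distrib_right)
  have T: "subspace T"
    unfolding subspace_def
  proof (intro conjI ballI allI)
    fix c :: real and t assume "t \<in> T"
    then obtain \<beta> where "\<beta> * e = \<beta>" "t = \<eta> * star \<beta>"
      by (auto simp: T_def)
    then have "c *\<^sub>R t = \<eta> * star (scaleC (complex_of_real c) \<beta>)"
      "scaleC (complex_of_real c) \<beta> * e = scaleC (complex_of_real c) \<beta>"
      by (simp_all add: star_scaleC scaleC_mult_left scaleC_mult_right flip: scaleC_of_real)
    then show "c *\<^sub>R t \<in> T"
      unfolding T_def by blast
  qed (use zero addT in auto)
  have jensen: "f (z + (g + g)) + f z = f (z + g) + f (z + g)" if "g \<in> S \<union> T" for z g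
    using that rank_one_Jensen[OF e \<xi> \<eta>] \<xi> \<eta> unfolding f_def S_def T_def by blast
  have double: "f (z + z) = f z + f z" for z
  proof -
    have "scaleC 2 v = v + v" for v :: 'b
      using scaleC_add_left[of 1 1 v] by simp
    then have "\<delta> (z + z) = \<delta> z + \<delta> z"
      using hom[of 2 z] by metis
    then show ?thesis
      by (simp add: f_def distrib_left distrib_right)
  qed
  have split: "\<exists>s\<in>S. \<exists>t\<in>T. (s + t) * \<xi> = z * \<xi> \<and> star \<eta> * (s + t) = star \<eta> * z" for z
    by (rule rank_two_approximation[OF e \<xi> \<eta>, of z]) (auto simp: S_def T_def)
  have cong: "f z = f w" if "z * \<xi> = w * \<xi>" "star \<eta> * z = star \<eta> * w" for z w
    unfolding f_def using that
    by (intro one[OF e \<xi> \<eta>, of _ _ 0]) (simp_all add: left_diff_distrib right_diff_distrib)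
  have "f (x + y) = f x + f y"
  proof -
    obtain s t where st: "s \<in> S" "t \<in> T" "(s + t) * \<xi> = x * \<xi>" "star \<eta> * (s + t) = star \<eta> * x"
      using split by blast
    obtain s' t' where st': "s' \<in> S" "t' \<in> T" "(s' + t') * \<xi> = y * \<xi>" "star \<eta> * (s' + t') = star \<eta> * y"
      using split by blast
    have "f (x + y) = f ((s + t) + (s' + t'))"
      by (rule cong) (simp_all only: distrib_right[of x] distrib_left[of _ x]
          distrib_right[of "s + t"] distrib_left[of _ "s + t"] st st')
    also have "\<dots> = f ((s + s') + (t + t'))"
      by (simp add: ac_simps)
    also have "\<dots> = f (s + t) + f (s' + t')"
      by (rule Jensen_two_subspaces[where f = f and S = S and T = T, OF jensen S T double st(1) st'(1) st(2) st'(2)])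
    also have "\<dots> = f x + f y"
      using cong[OF st(3,4)] cong[OF st'(3,4)] by simp
    finally show ?thesis .
  qed
  then show "star \<eta> * \<delta> (x + y) * \<xi> = star \<eta> * (\<delta> x + \<delta> y) * \<xi>"
    by (simp add: f_def distrib_left distrib_right)
qed

section \<open>The Leibniz rule on a fibre\<close>

lemma local_map_0: "\<delta> 0 = 0"
  using hom[of 0 0] by simp

lemma local_map_diff: "\<delta> (x - y) = \<delta> x - \<delta> y"
  using local_map_add[of "x - y" y] by simp

lemma local_map_vanishes:
  assumes "minimal_projection e" "\<xi> * e = \<xi>" "\<eta> * e = \<eta>"
    "x * \<xi> = scaleC c \<xi>" "star \<eta> * x = scaleC c (star \<eta>)"
  shows "star \<eta> * \<delta> x * \<xi> = 0"
  using one[of e \<xi> \<eta> x 0 c] assms by (simp add: local_map_0)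

text \<open>The four steps test \<open>\<delta>\<close> on \<open>p * q\<close>, \<open>q - p * q\<close>, \<open>p - p * q\<close> and \<open>p + q - p * q\<close>, which are the four
  products of \<open>p\<close> or \<open>1 - p\<close> with \<open>q\<close> or \<open>1 - q\<close>, up to sign and the absent unit.\<close>

lemma local_map_mult_idempotents:
  assumes p: "p * p = p" and q: "q * q = q"
  shows "\<delta> (p * q) = \<delta> p * q + p * \<delta> q"
proof -
  have pp: "p * (p * z) = p * z" and qq: "q * (q * z) = q * z" for z
    using p q by (metis mult.assoc)+
  have a: "\<delta> (p * q) - p * \<delta> (p * q) - \<delta> (p * q) * q + p * \<delta> (p * q) * q = 0"
  proof (rule separated_eqI[OF sep])
    fix e \<xi> \<eta> :: 'b
    assume e: "minimal_projection e" "\<xi> * e = \<xi>" "\<eta> * e = \<eta>"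
    \<comment> \<open>The vectors \<open>\<eta> - star p * \<eta>\<close> and
      \<open>\<xi> - q * \<xi>\<close> play the roles of \<open>1 - p\<close> on the left and
      \<open>1 - q\<close> on the right; both annihilate \<open>p * q\<close>.\<close>
    have "star (\<eta> - star p * \<eta>) * \<delta> (p * q) * (\<xi> - q * \<xi>) = 0"
      by (rule local_map_vanishes[where c = 0 and e = e])
        (simp_all add: e star_diff star_mult star_star algebra_simps pp qq mult.assoc)
    then show "star \<eta> * (\<delta> (p * q) - p * \<delta> (p * q) - \<delta> (p * q) * q + p * \<delta> (p * q) * q) * \<xi> = star \<eta> * 0 * \<xi>"
      by (simp add: star_diff star_mult star_star algebra_simps)
  qed
  have b: "p * \<delta> (q - p * q) - p * \<delta> (q - p * q) * q = 0"
  proof (rule separated_eqI[OF sep])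
    fix e \<xi> \<eta> :: 'b
    assume e: "minimal_projection e" "\<xi> * e = \<xi>" "\<eta> * e = \<eta>"
    have "star (star p * \<eta>) * \<delta> (q - p * q) * (\<xi> - q * \<xi>) = 0"
      by (rule local_map_vanishes[where c = 0 and e = e])
        (simp_all add: e star_diff star_mult star_star algebra_simps pp qq mult.assoc)
    then show "star \<eta> * (p * \<delta> (q - p * q) - p * \<delta> (q - p * q) * q) * \<xi> = star \<eta> * 0 * \<xi>"
      by (simp add: star_diff star_mult star_star algebra_simps)
  qed
  have c: "\<delta> (p - p * q) * q - p * \<delta> (p - p * q) * q = 0"
  proof (rule separated_eqI[OF sep])
    fix e \<xi> \<eta> :: 'b
    assume e: "minimal_projection e" "\<xi> * e = \<xi>" "\<eta> * e = \<eta>"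
    have "star (\<eta> - star p * \<eta>) * \<delta> (p - p * q) * (q * \<xi>) = 0"
      by (rule local_map_vanishes[where c = 0 and e = e])
        (simp_all add: e star_diff star_mult star_star algebra_simps pp qq mult.assoc p q)
    then show "star \<eta> * (\<delta> (p - p * q) * q - p * \<delta> (p - p * q) * q) * \<xi> = star \<eta> * 0 * \<xi>"
      by (simp add: star_diff star_mult star_star algebra_simps)
  qed
  have d: "p * \<delta> (p + q - p * q) * q = 0"
  proof (rule separated_eqI[OF sep])
    fix e \<xi> \<eta> :: 'b
    assume e: "minimal_projection e" "\<xi> * e = \<xi>" "\<eta> * e = \<eta>"
    \<comment> \<open>Formally \<open>p + q - p * q = 1 - (1 - p) * (1 - q)\<close>, so it acts as
      the identity after \<open>p\<close> on the left and before \<open>q\<close> on the right;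
      hence the eigenvalue 1.\<close>
    have "star (star p * \<eta>) * \<delta> (p + q - p * q) * (q * \<xi>) = 0"
      by (rule local_map_vanishes[where c = 1 and e = e])
        (simp_all add: e star_diff star_mult star_star algebra_simps pp qq mult.assoc p q)
    then show "star \<eta> * (p * \<delta> (p + q - p * q) * q) * \<xi> = star \<eta> * 0 * \<xi>"
      by (simp add: star_mult star_star mult.assoc)
  qed
  have "\<delta> (p * q) - (\<delta> p * q + p * \<delta> q) =
      (\<delta> (p * q) - p * \<delta> (p * q) - \<delta> (p * q) * q + p * \<delta> (p * q) * q)
      - (p * \<delta> (q - p * q) - p * \<delta> (q - p * q) * q)
      - (\<delta> (p - p * q) * q - p * \<delta> (p - p * q) * q) - p * \<delta> (p + q - p * q) * q"
    by (simp add: local_map_add local_map_diff algebra_simps)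
  then have "\<delta> (p * q) - (\<delta> p * q + p * \<delta> q) = 0"
    unfolding a b c d by simp
  then show ?thesis
    by (rule eq_iff_diff_eq_0[THEN iffD2])
qed

lemma local_map_mult_rank_one:
  assumes "minimal_projection e" "\<alpha> * e = \<alpha>" "\<beta> * e = \<beta>"
    and "minimal_projection e'" "\<alpha>' * e' = \<alpha>'" "\<beta>' * e' = \<beta>'"
  defines "x \<equiv> \<alpha> * star \<beta>" and "y \<equiv> \<alpha>' * star \<beta>'"
  shows "\<delta> (x * y) = \<delta> x * y + x * \<delta> y"
proof -
  obtain c d p q where x: "p * p = p" "q * q = q" "x = scaleC c p - scaleC d q"
    using rank_one_eq_diff_idempotents[OF assms(1-3)] unfolding x_def .
  obtain c' d' p' q' where y: "p' * p' = p'" "q' * q' = q'" "y = scaleC c' p' - scaleC d' q'"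
    using rank_one_eq_diff_idempotents[OF assms(4-6)] unfolding y_def .
  show ?thesis
    unfolding x(3) y(3)
    by (simp add: local_map_diff hom scaleC_mult_left scaleC_mult_right scaleC_scaleC
        scaleC_add_right scaleC_diff_right left_diff_distrib right_diff_distrib
        local_map_mult_idempotents x(1,2) y(1,2) mult.commute)
qed

lemma local_map_mult: "\<delta> (x * y) = \<delta> x * y + x * \<delta> y"
proof (rule separated_eqI[OF sep])
  fix e \<xi> \<eta> :: 'b
  assume e: "minimal_projection e" and \<xi>: "\<xi> * e = \<xi>" and \<eta>: "\<eta> * e = \<eta>"
  have cong: "star \<eta> * \<delta> z * \<xi> = star \<eta> * \<delta> w * \<xi>"
    if "\<xi> * e = \<xi>" "\<eta> * e = \<eta>" "z * \<xi> = w * \<xi>" "star \<eta> * z = star \<eta> * w" for z w \<xi> \<eta>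
    using that by (intro one[OF e, of _ _ _ _ 0]) (simp_all add: left_diff_distrib right_diff_distrib)
  have y\<xi>: "y * \<xi> * e = y * \<xi>"
    by (simp add: mult.assoc \<xi>)
  obtain \<alpha> \<beta> where ab: "\<alpha> * e = \<alpha>" "\<beta> * e = \<beta>"
    and x: "(\<alpha> * star (y * \<xi>) + \<eta> * star \<beta>) * (y * \<xi>) = x * (y * \<xi>)"
      "star \<eta> * (\<alpha> * star (y * \<xi>) + \<eta> * star \<beta>) = star \<eta> * x"
    using rank_two_approximation[OF e y\<xi> \<eta>, of x] .
  define x' where "x' = \<alpha> * star (y * \<xi>) + \<eta> * star \<beta>"
  note x = x[folded x'_def]
  \<comment> \<open>The order of the choices matters: \<open>x'\<close> is fixed first, and
    \<open>y'\<close> must agree with \<open>y\<close> on \<xi> and against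
    \<open>star \<eta> * x'\<close>. Then \<open>x' * y'\<close> and \<open>x * y\<close> have the
    same image of \<xi> and the same product with \<open>star \<eta>\<close>.\<close>
  have x'\<eta>: "star x' * \<eta> * e = star x' * \<eta>"
    by (simp add: mult.assoc \<eta>)
  obtain \<alpha>' \<beta>' where ab': "\<alpha>' * e = \<alpha>'" "\<beta>' * e = \<beta>'"
    and y: "(\<alpha>' * star \<xi> + (star x' * \<eta>) * star \<beta>') * \<xi> = y * \<xi>"
      "star (star x' * \<eta>) * (\<alpha>' * star \<xi> + (star x' * \<eta>) * star \<beta>') = star (star x' * \<eta>) * y"
    using rank_two_approximation[OF e \<xi> x'\<eta>, of y] .
  define y' where "y' = \<alpha>' * star \<xi> + (star x' * \<eta>) * star \<beta>'"
  note y = y[folded y'_def]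
  have y2: "star \<eta> * x' * y' = star \<eta> * x' * y"
    using y(2) by (simp add: star_mult star_star)
  have rank: "\<delta> (x' * y') = \<delta> x' * y' + x' * \<delta> y'"
    unfolding x'_def y'_def
    by (simp add: distrib_left distrib_right local_map_add
        local_map_mult_rank_one[OF e _ _ e] ab ab' y\<xi> \<eta> \<xi> x'\<eta>[unfolded x'_def])
  have "star \<eta> * \<delta> (x * y) * \<xi> = star \<eta> * \<delta> (x' * y') * \<xi>"
    by (rule cong[OF \<xi> \<eta>]) (metis x(1) y(1) mult.assoc, metis x(2) y2 mult.assoc)
  also have "\<dots> = star \<eta> * \<delta> x' * (y * \<xi>) + star (star x' * \<eta>) * \<delta> y' * \<xi>"
    by (simp add: rank distrib_left distrib_right mult.assoc y(1) star_mult star_star)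
  also have "star \<eta> * \<delta> x' * (y * \<xi>) = star \<eta> * \<delta> x * (y * \<xi>)"
    by (rule cong[OF y\<xi> \<eta> x])
  also have "star (star x' * \<eta>) * \<delta> y' * \<xi> = star (star x' * \<eta>) * \<delta> y * \<xi>"
    by (rule cong[OF \<xi> x'\<eta> y])
  also have "\<dots> = star \<eta> * x * \<delta> y * \<xi>"
    using x(2) by (simp add: star_mult star_star)
  finally show "star \<eta> * \<delta> (x * y) * \<xi> = star \<eta> * (\<delta> x * y + x * \<delta> y) * \<xi>"
    by (simp add: distrib_left distrib_right mult.assoc)
qed

lemma local_map_derivation: "derivation \<delta>"
  unfolding derivation_def using local_map_add hom local_map_mult by blast

end

section \<open>Weak-2-local derivations on function algebras\<close>

text \<open>Turns coefficients in the one-dimensional corner into scalars, as membership in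
  \<open>cdual\<close> requires. Since \<open>e\<close> is nonzero the scalar is unique, hence
  linear in \<open>b\<close>.\<close>

lemma minimal_projection_functional:
  fixes e :: "'b::cstar_algebra"
  assumes e: "minimal_projection e"
  obtains \<psi> where "\<psi> \<in> cdual" "\<And>b. e * b * e = scaleC (\<psi> b) e"
proof -
  have e0: "e \<noteq> 0"
    using e by (simp add: minimal_projection_def)
  obtain \<psi> where \<psi>: "\<And>b. e * b * e = scaleC (\<psi> b) e"
    using e unfolding minimal_projection_def by metis
  have eqI: "\<psi> b = c" if "e * b * e = scaleC c e" for b c
    using that \<psi>[of b] scaleC_cancel_right[OF e0] by metis
  have scale: "\<psi> (scaleC c x) = c * \<psi> x" for c x
    by (rule eqI) (simp add: scaleC_mult_left scaleC_mult_right \<psi> scaleC_scaleC)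
  have "bounded_linear \<psi>"
  proof (rule bounded_linear_intro)
    show "\<psi> (x + y) = \<psi> x + \<psi> y" for x y
      by (rule eqI) (simp add: distrib_left distrib_right \<psi> scaleC_add_left)
    show "\<psi> (r *\<^sub>R x) = r *\<^sub>R \<psi> x" for r x
      using scale[of "complex_of_real r" x] by (simp add: scaleC_of_real scaleR_conv_of_real)
    show "norm (\<psi> x) \<le> norm x * norm e" for x
    proof -
      have "norm (\<psi> x) * norm e = norm (e * x * e)"
        by (simp add: \<psi> norm_scaleC)
      also have "\<dots> \<le> norm e * norm x * norm e"
        by (meson norm_mult_ineq mult_right_mono norm_ge_zero order_trans)
      finally show ?thesis
        using e0 by (simp add: mult.commute)
    qed
  qed
  with scale have "\<psi> \<in> cdual"
    by (simp add: cdual_def)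
  then show ?thesis
    using \<psi> that by blast
qed

lemma cdual_add: "\<lbrakk>\<phi> \<in> cdual; \<psi> \<in> cdual\<rbrakk> \<Longrightarrow> (\<lambda>a. \<phi> a + \<psi> a) \<in> cdual"
  by (simp add: cdual_def bounded_linear_add distrib_left)

lemma bounded_linear_apply_bcontfun: "bounded_linear (\<lambda>f. apply_bcontfun f x)"
  by (rule bounded_linear_intro[where K = 1]) (simp_all add: norm_bounded)

lemma matrix_coefficient:
  fixes \<psi> :: "'b::cstar_algebra \<Rightarrow> complex" and w :: "'x::topological_space"
  assumes "\<psi> \<in> cdual"
  shows "(\<lambda>a :: 'x \<Rightarrow>\<^sub>C 'b. \<psi> (star \<eta> * apply_bcontfun a w * \<xi>)) \<in> cdual"
proof -
  have "bounded_linear \<psi>"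
    using assms by (simp add: cdual_def)
  from bounded_linear_compose[OF this
      bounded_linear_compose[OF bounded_linear_mult_left
        bounded_linear_compose[OF bounded_linear_mult_right bounded_linear_apply_bcontfun]]]
  show ?thesis
    using assms by (simp add: cdual_def scaleC_bcontfun.rep_eq scaleC_mult_left scaleC_mult_right)
qed

text \<open>The map has norm \<open>sqrt (norm b)\<close>, so it tends to its value 0 at the origin.
  It serves to split off a square root from a function vanishing at a point.\<close>

lemma continuous_scaleR_inverse_sqrt_norm:
  "continuous_on UNIV (\<lambda>b :: 'b::real_normed_vector. (1 / sqrt (norm b)) *\<^sub>R b)"
proof (rule continuous_at_imp_continuous_on, rule ballI)
  fix b :: 'b
  show "isCont (\<lambda>b. (1 / sqrt (norm b)) *\<^sub>R b) b"
  proof (cases "b = 0")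
    case False
    then show ?thesis by (intro continuous_intros) auto
  next
    case True
    have "((\<lambda>b :: 'b. sqrt (norm b)) \<longlongrightarrow> sqrt (norm (0 :: 'b))) (at 0)"
      by (intro tendsto_intros)
    moreover have "norm ((1 / sqrt (norm b)) *\<^sub>R b) = sqrt (norm b)" for b :: 'b
      by (simp add: real_div_sqrt)
    ultimately have "((\<lambda>b :: 'b. (1 / sqrt (norm b)) *\<^sub>R b) \<longlongrightarrow> 0) (at 0)"
      by - (rule tendsto_norm_zero_cancel, simp only: norm_zero real_sqrt_zero)
    with True show ?thesis
      by (simp add: isCont_def)
  qed
qed

text \<open>No automatic continuity of derivations is needed: \<open>k\<close> is a product of two functions vanishing
  at \<open>w\<close>.\<close>

lemma derivation_vanishes_at:
  fixes D :: "('x::topological_space \<Rightarrow>\<^sub>C 'b::cstar_algebra) \<Rightarrow> ('x \<Rightarrow>\<^sub>C 'b)"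
  assumes D: "derivation D" and k0: "apply_bcontfun k w = 0"
    and ke: "k * const_bcontfun e = k"
  shows "apply_bcontfun (D k) w = 0"
proof -
  \<comment> \<open>Both factors have norm proportional to the square root of the norm of
    \<open>k\<close>, so both vanish at \<open>w\<close>; \<open>ke\<close> makes their product
    \<open>k\<close>.\<close>
  let ?k1 = "\<lambda>x. (1 / sqrt (norm (apply_bcontfun k x))) *\<^sub>R apply_bcontfun k x"
  let ?g = "\<lambda>x. sqrt (norm (apply_bcontfun k x)) *\<^sub>R e"
  have le: "sqrt (norm (apply_bcontfun k x)) \<le> sqrt (norm k)" for x
    by (simp add: norm_bounded)
  have "continuous_on UNIV ?k1"
    using continuous_on_compose2[OF continuous_scaleR_inverse_sqrt_norm, of UNIV "apply_bcontfun k"]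
    by simp
  then have k1: "?k1 \<in> bcontfun"
    using le by (intro bcontfun_normI[where b = "sqrt (norm k)"]) (auto simp: real_div_sqrt)
  have "continuous_on UNIV ?g"
    by (intro continuous_intros) auto
  then have g: "?g \<in> bcontfun"
    using le by (intro bcontfun_normI[where b = "sqrt (norm k) * norm e"]) (auto intro!: mult_right_mono)
  have ke': "apply_bcontfun k x * e = apply_bcontfun k x" for x
    using arg_cong[OF ke, of "\<lambda>f. apply_bcontfun f x"]
    by (simp add: times_bcontfun.rep_eq const_bcontfun.rep_eq)
  have "k = Bcontfun ?k1 * Bcontfun ?g"
    by (rule bcontfun_eqI)
      (auto simp: times_bcontfun.rep_eq Bcontfun_inverse[OF k1] Bcontfun_inverse[OF g] ke')
  then have "D k = D (Bcontfun ?k1) * Bcontfun ?g + Bcontfun ?k1 * D (Bcontfun ?g)"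
    using derivationD(3)[OF D] by metis
  then show ?thesis
    by (simp add: times_bcontfun.rep_eq Bcontfun_inverse[OF k1] Bcontfun_inverse[OF g] k0)
qed

text \<open>The function \<open>c * \<xi>\<close> minus its constant value at \<open>w\<close>
  vanishes at \<open>w\<close>, and so does its image under \<open>D\<close>. Expanding by the
  Leibniz rule leaves only values of \<open>D\<close> on constants.\<close>

lemma derivation_fiber:
  fixes D :: "('x::topological_space \<Rightarrow>\<^sub>C 'b::cstar_algebra) \<Rightarrow> ('x \<Rightarrow>\<^sub>C 'b)"
  assumes D: "derivation D" and \<xi>: "\<xi> * e = \<xi>"
  shows "apply_bcontfun (D c) w * \<xi> =
    apply_bcontfun (D (const_bcontfun (apply_bcontfun c w * \<xi>))) w
    - apply_bcontfun c w * apply_bcontfun (D (const_bcontfun \<xi>)) w"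
proof -
  let ?k = "c * const_bcontfun \<xi> - const_bcontfun (apply_bcontfun c w * \<xi>)"
  have "apply_bcontfun (D ?k) w = 0"
    by (rule derivation_vanishes_at[OF D, where e = e])
      (auto intro!: bcontfun_eqI simp: times_bcontfun.rep_eq const_bcontfun.rep_eq left_diff_distrib mult.assoc \<xi>)
  then show ?thesis
    by (simp add: derivationD[OF D] times_bcontfun.rep_eq const_bcontfun.rep_eq algebra_simps)
qed

lemma const_bcontfun_linear:
  "const_bcontfun (x + y) = const_bcontfun x + (const_bcontfun y :: 'x::topological_space \<Rightarrow>\<^sub>C 'b::cstar_algebra)"
  "const_bcontfun (scaleC c x) = scaleC c (const_bcontfun x :: 'x \<Rightarrow>\<^sub>C 'b)"
  by (auto intro!: bcontfun_eqI simp: const_bcontfun.rep_eq scaleC_bcontfun.rep_eq)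

text \<open>A single \<open>D\<close> serves both points, so the difference of the two values is
  \<open>\<phi> (D (a - b))\<close>.\<close>

lemma weak_2_local_derivation_cong:
  assumes \<Delta>: "weak_2_local_derivation \<Delta>" and \<phi>: "\<phi> \<in> cdual"
    and zero: "\<And>D. derivation D \<Longrightarrow> \<phi> (D (a - b)) = 0"
  shows "\<phi> (\<Delta> a) = \<phi> (\<Delta> b)"
proof -
  obtain D where D: "derivation D" "\<phi> (\<Delta> a) = \<phi> (D a)" "\<phi> (\<Delta> b) = \<phi> (D b)"
    using \<Delta> \<phi> unfolding weak_2_local_derivation_def by metis
  have "linear \<phi>"
    using \<phi> by (simp add: cdual_def bounded_linear.linear)
  then have "\<phi> (D (a - b)) = \<phi> (D a) - \<phi> (D b)"
    by (simp add: derivationD(5)[OF D(1)] linear_diff)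
  with zero[OF D(1)] D(2,3) show ?thesis
    by simp
qed

lemma corner_eqI:
  assumes e: "minimal_projection e" "\<xi> * e = \<xi>" "\<eta> * e = \<eta>" and \<psi>: "\<And>b. e * b * e = scaleC (\<psi> b) e"
    and eq: "\<psi> (star \<eta> * a * \<xi>) = \<psi> (star \<eta> * b * \<xi>)"
  shows "star \<eta> * a * \<xi> = star \<eta> * (b::'b::cstar_algebra) * \<xi>"
proof -
  have "e * star \<eta> = star \<eta>"
    using e by (metis minimal_projection_def star_mult)
  then have "star \<eta> * z * \<xi> = e * (star \<eta> * z * \<xi>) * e" for z
    using e(2) by (metis mult.assoc)
  then show ?thesis
    using \<psi> eq by metis
qed

context
  fixes \<Delta> :: "('x::topological_space \<Rightarrow>\<^sub>C 'b::cstar_algebra) \<Rightarrow> ('x \<Rightarrow>\<^sub>C 'b)"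
  assumes sep: "separated_by_minimal_projections TYPE('b)"
    and \<Delta>: "weak_2_local_derivation \<Delta>"
begin

lemma weak_2_local_scaleC: "\<Delta> (scaleC c a) = scaleC c (\<Delta> a)"
proof (rule bcontfun_eqI, rule separated_eqI[OF sep])
  fix w :: 'x and e \<xi> \<eta> :: 'b
  assume e: "minimal_projection e" "\<xi> * e = \<xi>" "\<eta> * e = \<eta>"
  obtain \<psi> where \<psi>: "\<psi> \<in> cdual" "\<And>b. e * b * e = scaleC (\<psi> b) e"
    using minimal_projection_functional[OF e(1)] by blast
  let ?\<phi> = "\<lambda>a :: 'x \<Rightarrow>\<^sub>C 'b. \<psi> (star \<eta> * apply_bcontfun a w * \<xi>)"
  have \<phi>: "?\<phi> \<in> cdual"
    by (rule matrix_coefficient[OF \<psi>(1)])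
  then have scale: "?\<phi> (scaleC c x) = c * ?\<phi> x" for x
    by (simp add: cdual_def)
  obtain D where D: "derivation D" "?\<phi> (\<Delta> a) = ?\<phi> (D a)"
    "?\<phi> (\<Delta> (scaleC c a)) = ?\<phi> (D (scaleC c a))"
    using bspec[OF spec[OF spec[OF \<Delta>[unfolded weak_2_local_derivation_def], of a], of "scaleC c a"] \<phi>]
    by blast
  have "?\<phi> (\<Delta> (scaleC c a)) = ?\<phi> (scaleC c (\<Delta> a))"
    using D scale by (simp add: derivationD)
  then show "star \<eta> * apply_bcontfun (\<Delta> (scaleC c a)) w * \<xi> = star \<eta> * apply_bcontfun (scaleC c (\<Delta> a)) w * \<xi>"
    by (rule corner_eqI[OF e \<psi>(2)])
qed

text \<open>By \<open>derivation_fiber\<close>, the coefficient of \<open>D (a - b)\<close> is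
  \<open>c\<close> times the coefficient of \<open>D\<close> on the constant \<xi>, minus the same
  quantity.\<close>

lemma weak_2_local_one:
  fixes w :: 'x
  assumes e: "minimal_projection e" "\<xi> * e = \<xi>" "\<eta> * e = \<eta>"
    and left: "apply_bcontfun (a - b) w * \<xi> = scaleC c \<xi>"
    and right: "star \<eta> * apply_bcontfun (a - b) w = scaleC c (star \<eta>)"
  shows "star \<eta> * apply_bcontfun (\<Delta> a) w * \<xi> = star \<eta> * apply_bcontfun (\<Delta> b) w * \<xi>"
proof -
  obtain \<psi> where \<psi>: "\<psi> \<in> cdual" "\<And>b. e * b * e = scaleC (\<psi> b) e"
    using minimal_projection_functional[OF e(1)] by blast
  have \<psi>0: "\<psi> 0 = 0"
    using \<psi>(1) by (simp add: cdual_def bounded_linear.linear linear_0)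
  have "\<psi> (star \<eta> * apply_bcontfun (D (a - b)) w * \<xi>) = 0" if D: "derivation D" for D
  proof -
    have "star \<eta> * apply_bcontfun (D (a - b)) w * \<xi> =
      star \<eta> * apply_bcontfun (D (const_bcontfun (scaleC c \<xi>))) w
      - star \<eta> * apply_bcontfun (a - b) w * apply_bcontfun (D (const_bcontfun \<xi>)) w"
      by (simp only: mult.assoc derivation_fiber[OF D e(2)] left right_diff_distrib)
    also have "\<dots> = 0"
      unfolding right
      by (simp add: const_bcontfun_linear derivationD[OF D] scaleC_bcontfun.rep_eq scaleC_mult_left scaleC_mult_right)
    finally show ?thesis
      by (simp only: \<psi>0)
  qed
  then have "\<psi> (star \<eta> * apply_bcontfun (\<Delta> a) w * \<xi>) = \<psi> (star \<eta> * apply_bcontfun (\<Delta> b) w * \<xi>)"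
    by (rule weak_2_local_derivation_cong[OF \<Delta> matrix_coefficient[OF \<psi>(1)]])
  then show ?thesis
    by (rule corner_eqI[OF e \<psi>(2)])
qed

text \<open>The two coefficients of \<open>D (a - b)\<close> need not vanish separately. The terms
  with the diagonal inner products \<open>p\<close> and \<open>s\<close> cancel within each one, and
  the cross terms with \<open>q\<close> and \<open>r\<close> cancel between the two.\<close>

lemma weak_2_local_two:
  fixes w :: 'x
  assumes e: "minimal_projection e" "\<xi> * e = \<xi>" "\<eta> * e = \<eta>" "\<alpha> * e = \<alpha>" "\<beta> * e = \<beta>"
    and diff: "apply_bcontfun (a - b) w = \<xi> * star \<eta> + \<alpha> * star \<beta>"
  shows "star \<eta> * apply_bcontfun (\<Delta> a) w * \<xi> + star \<beta> * apply_bcontfun (\<Delta> a) w * \<alpha> =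
    star \<eta> * apply_bcontfun (\<Delta> b) w * \<xi> + star \<beta> * apply_bcontfun (\<Delta> b) w * \<alpha>"
proof -
  obtain \<psi> where \<psi>: "\<psi> \<in> cdual" "\<And>b. e * b * e = scaleC (\<psi> b) e"
    using minimal_projection_functional[OF e(1)] by blast
  have lin: "linear \<psi>"
    using \<psi>(1) by (simp add: cdual_def bounded_linear.linear)
  have star_e: "e * star \<eta> = star \<eta>" "e * star \<beta> = star \<beta>"
    using e by (metis minimal_projection_def star_mult)+
  obtain p where p: "star \<eta> * \<xi> = scaleC p e" using minimal_projection_inner[OF e(1,2,3)] .
  obtain q where q: "star \<beta> * \<xi> = scaleC q e" using minimal_projection_inner[OF e(1,2,5)] .
  obtain r where r: "star \<eta> * \<alpha> = scaleC r e" using minimal_projection_inner[OF e(1,4,3)] .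
  obtain s where s: "star \<beta> * \<alpha> = scaleC s e" using minimal_projection_inner[OF e(1,4,5)] .
  let ?\<phi> = "\<lambda>a :: 'x \<Rightarrow>\<^sub>C 'b. \<psi> (star \<eta> * apply_bcontfun a w * \<xi>) + \<psi> (star \<beta> * apply_bcontfun a w * \<alpha>)"
  have \<phi>: "?\<phi> \<in> cdual"
    by (intro cdual_add matrix_coefficient \<psi>(1))
  have "?\<phi> (D (a - b)) = 0" if D: "derivation D" for D
  proof -
    define W where "W z = apply_bcontfun (D (const_bcontfun z)) w" for z
    have W: "W (x + y) = W x + W y" "W (scaleC c x) = scaleC c (W x)" for x y c
      by (simp_all add: W_def const_bcontfun_linear derivationD[OF D] scaleC_bcontfun.rep_eq)
    have fiber: "apply_bcontfun (D (a - b)) w * \<zeta> = W ((\<xi> * star \<eta> + \<alpha> * star \<beta>) * \<zeta>) - (\<xi> * star \<eta> + \<alpha> * star \<beta>) * W \<zeta>"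
      if "\<zeta> * e = \<zeta>" for \<zeta>
      unfolding W_def derivation_fiber[OF D that] diff ..
    have pull: "star \<eta> * (\<xi> * z) = scaleC p (e * z)" "star \<beta> * (\<xi> * z) = scaleC q (e * z)"
      "star \<eta> * (\<alpha> * z) = scaleC r (e * z)" "star \<beta> * (\<alpha> * z) = scaleC s (e * z)"
      "e * (star \<eta> * z) = star \<eta> * z" "e * (star \<beta> * z) = star \<beta> * z" for z
      using p q r s star_e by (metis mult.assoc scaleC_mult_left)+
    have "star \<eta> * (apply_bcontfun (D (a - b)) w * \<xi>) + star \<beta> * (apply_bcontfun (D (a - b)) w * \<alpha>) = 0"
      unfolding fiber[OF e(2)] fiber[OF e(4)]
      by (simp add: distrib_right distrib_left right_diff_distrib mult.assoc p q r s e
          scaleC_mult_left scaleC_mult_right W pull)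
    then show ?thesis
      using lin by (simp add: linear_0 mult.assoc flip: linear_add)
  qed
  then have "?\<phi> (\<Delta> a) = ?\<phi> (\<Delta> b)"
    by (rule weak_2_local_derivation_cong[OF \<Delta> \<phi>])
  then have "scaleC (?\<phi> (\<Delta> a)) e = scaleC (?\<phi> (\<Delta> b)) e"
    by simp
  moreover have "e * (star \<eta> * z * \<xi>) * e = star \<eta> * z * \<xi>" "e * (star \<beta> * z * \<alpha>) * e = star \<beta> * z * \<alpha>" for z
    using star_e e by (metis mult.assoc)+
  ultimately show ?thesis
    by (simp add: scaleC_add_left flip: \<psi>(2))
qed

theorem weak_2_local_derivation_imp_derivation: "derivation \<Delta>"
proof -
  define \<delta> where "\<delta> w x = apply_bcontfun (\<Delta> (const_bcontfun x)) w" for w x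
  \<comment> \<open>The functions \<open>a\<close> and the constant \<open>a(w)\<close> differ by a
    function vanishing at \<open>w\<close>, so \<open>weak_2_local_one\<close> applies with
    eigenvalue 0.\<close>
  have fiber: "apply_bcontfun (\<Delta> a) w = \<delta> w (apply_bcontfun a w)" for a w
  proof (rule separated_eqI[OF sep])
    fix e \<xi> \<eta> :: 'b
    assume "minimal_projection e" "\<xi> * e = \<xi>" "\<eta> * e = \<eta>"
    then show "star \<eta> * apply_bcontfun (\<Delta> a) w * \<xi> = star \<eta> * \<delta> w (apply_bcontfun a w) * \<xi>"
      unfolding \<delta>_def by (rule weak_2_local_one[where c = 0]) (simp_all add: const_bcontfun.rep_eq)
  qed
  have "derivation (\<delta> w)" for w
  proof (rule local_map_derivation[OF sep])
    show "\<delta> w (scaleC c x) = scaleC c (\<delta> w x)" for c x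
      by (simp add: \<delta>_def const_bcontfun_linear weak_2_local_scaleC scaleC_bcontfun.rep_eq)
    show "star \<eta> * \<delta> w x * \<xi> = star \<eta> * \<delta> w y * \<xi>"
      if "minimal_projection e" "\<xi> * e = \<xi>" "\<eta> * e = \<eta>" "(x - y) * \<xi> = scaleC c \<xi>"
        "star \<eta> * (x - y) = scaleC c (star \<eta>)" for e \<xi> \<eta> c x y
      unfolding \<delta>_def using that
      by (intro weak_2_local_one[where c = c and e = e]) (simp_all add: const_bcontfun.rep_eq)
    show "star \<eta> * \<delta> w x * \<xi> + star \<beta> * \<delta> w x * \<alpha> = star \<eta> * \<delta> w y * \<xi> + star \<beta> * \<delta> w y * \<alpha>"
      if "minimal_projection e" "\<xi> * e = \<xi>" "\<eta> * e = \<eta>" "\<alpha> * e = \<alpha>" "\<beta> * e = \<beta>"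
        "x - y = \<xi> * star \<eta> + \<alpha> * star \<beta>" for e \<xi> \<eta> \<alpha> \<beta> x y
      unfolding \<delta>_def using that
      by (intro weak_2_local_two[where e = e]) (simp_all add: const_bcontfun.rep_eq)
  qed
  then show ?thesis
    unfolding derivation_def
    by (auto intro!: bcontfun_eqI simp: fiber scaleC_bcontfun.rep_eq times_bcontfun.rep_eq derivation_def)
qed

end

section \<open>Minimal projections in compact C*-algebras\<close>

context complex_hilbert_space
begin

section \<open>Inner products and norms on the carrier of a Hilbert space\<close>

lemma inner_add_right:
  "\<lbrakk>x \<in> hcarrier H; y \<in> hcarrier H; z \<in> hcarrier H\<rbrakk>
    \<Longrightarrow> hinner H x (hadd H y z) = hinner H x y + hinner H x z"
  using inner_commute[of "hadd H y z" x] inner_commute[of y x] inner_commute[of z x]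
  by (simp add: inner_add_left add_closed)

lemma inner_scale_right:
  "\<lbrakk>x \<in> hcarrier H; y \<in> hcarrier H\<rbrakk> \<Longrightarrow> hinner H x (hscale H c y) = cnj c * hinner H x y"
  using inner_commute[of "hscale H c y" x] inner_commute[of y x]
  by (simp add: inner_scale_left scale_closed)

lemma inner_self:
  assumes "x \<in> hcarrier H"
  shows "hinner H x x = complex_of_real ((hnorm H x)\<^sup>2)"
proof -
  have "Im (hinner H x x) = 0"
    using arg_cong[OF inner_commute[OF assms assms], of Im] by simp
  then show ?thesis
    using inner_nonneg[OF assms] by (simp add: hnorm_def complex_eq_iff)
qed

lemma scale_0: "x \<in> hcarrier H \<Longrightarrow> hscale H 0 x = hzero H"
  using scale_add_left[of x 1 "- 1"] by (simp add: scale_one add_neg)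

lemma scale_hzero: "hscale H c (hzero H) = hzero H"
  using scale_scale[OF zero_closed, of c 0] scale_0[OF zero_closed] by simp

lemma inner_zero_left: "x \<in> hcarrier H \<Longrightarrow> hinner H (hzero H) x = 0"
  using inner_scale_left[OF zero_closed, of x 0] scale_0[OF zero_closed] by simp

lemma inner_eqI:
  assumes x: "x \<in> hcarrier H" and y: "y \<in> hcarrier H"
    and eq: "\<And>z. z \<in> hcarrier H \<Longrightarrow> hinner H z x = hinner H z y"
  shows "x = y"
proof -
  let ?d = "hadd H x (hscale H (- 1) y)"
  have d: "?d \<in> hcarrier H"
    by (intro add_closed scale_closed x y)
  have "hinner H ?d ?d = 0"
    by (subst inner_add_right) (simp_all add: inner_scale_right eq d x y scale_closed)
  then have "?d = hzero H"
    by (rule inner_eq_zero[OF d])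
  then have "y = hadd H ?d y"
    using add_zero[OF y] by simp
  also have "\<dots> = hadd H x (hadd H y (hscale H (- 1) y))"
    using x y by (simp add: add_assoc scale_closed add_commute[of y])
  also have "\<dots> = x"
    using x y by (simp add: add_neg add_commute[of x] zero_closed add_zero)
  finally show ?thesis by simp
qed

lemma hnorm_nonneg: "x \<in> hcarrier H \<Longrightarrow> 0 \<le> hnorm H x"
  by (simp add: hnorm_def inner_nonneg)

lemma hnorm_scale: "x \<in> hcarrier H \<Longrightarrow> hnorm H (hscale H c x) = cmod c * hnorm H x"
proof -
  assume x: "x \<in> hcarrier H"
  have "hinner H (hscale H c x) (hscale H c x) = c * cnj c * hinner H x x"
    using x by (simp add: inner_scale_left inner_scale_right scale_closed)
  also have "\<dots> = complex_of_real ((cmod c * hnorm H x)\<^sup>2)"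
    by (simp add: inner_self[OF x] power_mult_distrib flip: complex_norm_square)
  finally have "hinner H (hscale H c x) (hscale H c x) = complex_of_real ((cmod c * hnorm H x)\<^sup>2)" .
  then show ?thesis
    using hnorm_nonneg[OF x] by (simp add: hnorm_def[of H "hscale H c x"] del: of_real_power of_real_mult)
qed

lemma hnorm_zero: "hnorm H (hzero H) = 0"
  using hnorm_scale[OF zero_closed, of 0] by (simp add: scale_hzero)

lemma Cauchy_Schwarz:
  assumes x: "x \<in> hcarrier H" and y: "y \<in> hcarrier H"
  shows "cmod (hinner H x y) \<le> hnorm H x * hnorm H y"
proof (cases "hnorm H y = 0")
  case True
  then have "y = hzero H"
    using inner_eq_zero[OF y] inner_self[OF y] by simp
  then show ?thesis
    using inner_commute[OF zero_closed x] inner_zero_left[OF x] by (simp add: hnorm_zero)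
next
  case False
  define N where "N = (hnorm H y)\<^sup>2"
  define c where "c = hinner H x y"
  \<comment> \<open>This is \<open>N\<close> times the component of \<open>x\<close> orthogonal to
    \<open>y\<close>.\<close>
  let ?z = "hadd H (hscale H N x) (hscale H (- c) y)"
  have N: "N > 0" "hinner H y y = N"
    using False inner_self[OF y] by (auto simp: N_def)
  have yx: "hinner H y x = cnj c"
    unfolding c_def by (rule inner_commute[OF x y])
  have z: "?z \<in> hcarrier H"
    by (intro add_closed scale_closed x y)
  have "hinner H ?z ?z = of_real (N * (N * (hnorm H x)\<^sup>2)) - N * (c * cnj c)"
    using x y by (simp add: inner_add_left inner_add_right inner_scale_left inner_scale_right
        scale_closed add_closed N yx inner_self[OF x] algebra_simps flip: c_def)
  also have "\<dots> = of_real (N * (N * (hnorm H x)\<^sup>2 - (cmod c)\<^sup>2))"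
    by (simp add: right_diff_distrib flip: complex_norm_square)
  finally have "0 \<le> N * (N * (hnorm H x)\<^sup>2 - (cmod c)\<^sup>2)"
    using inner_nonneg[OF z] by (simp del: of_real_mult of_real_diff)
  then have "(cmod c)\<^sup>2 \<le> (hnorm H x * hnorm H y)\<^sup>2"
    using N(1) by (simp add: zero_le_mult_iff N_def power_mult_distrib mult.commute)
  then show ?thesis
    unfolding c_def by (rule power2_le_imp_le) (simp add: hnorm_nonneg x y)
qed

text \<open>A subset of a relatively compact set is relatively compact, so \<open>K(H)\<close> is stable under composition
  with contractions on the right. This avoids the metric topology, whose library theory demands that
  \<open>hdist\<close> be symmetric and nonnegative also outside the carrier.\<close>

lemma rank_one_compact:
  assumes T: "T \<in> compact_operators H" and u: "u \<in> hcarrier H" and v: "v \<in> hcarrier H"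
    and le: "hnorm H u * hnorm H v \<le> 1"
  shows "(\<lambda>x\<in>hcarrier H. hscale H (hinner H x u) (T v)) \<in> compact_operators H"
proof -
  let ?R = "\<lambda>x\<in>hcarrier H. hscale H (hinner H x u) (T v)"
  have Tv: "T v \<in> hcarrier H"
    using T v by (auto simp: compact_operators_def)
  \<comment> \<open>The operator is \<open>T\<close> after the map sending \<open>x\<close> to
    \<open>hinner H x u\<close> times \<open>v\<close>, a contraction by Cauchy-Schwarz.\<close>
  have "?R ` hunit_ball H \<subseteq> T ` hunit_ball H"
  proof (rule image_subsetI)
    fix x assume "x \<in> hunit_ball H"
    then have x: "x \<in> hcarrier H" "hnorm H x \<le> 1"
      by (auto simp: hunit_ball_def)
    have "cmod (hinner H x u) * hnorm H v \<le> (hnorm H x * hnorm H u) * hnorm H v"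
      by (intro mult_right_mono Cauchy_Schwarz hnorm_nonneg x u v)
    also have "\<dots> \<le> 1 * 1"
      unfolding mult.assoc by (intro mult_mono le x mult_nonneg_nonneg hnorm_nonneg u v) simp
    finally have "hscale H (hinner H x u) v \<in> hunit_ball H"
      by (simp add: hunit_ball_def hnorm_scale scale_closed v)
    moreover have "?R x = T (hscale H (hinner H x u) v)"
      using T v x by (simp add: compact_operators_def)
    ultimately show "?R x \<in> T ` hunit_ball H"
      by simp
  qed
  from closure_of_mono[OF this, of "htopology H"]
  have "compactin (htopology H) (htopology H closure_of (?R ` hunit_ball H))"
    using T by (auto simp only: compact_operators_def mem_Collect_eq
        intro: closed_compactin closedin_closure_of)
  then show ?thesis
    using Tv u by (simp add: compact_operators_def scale_closed add_closed inner_add_left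
        inner_scale_left scale_add_left scale_scale)
qed

end

text \<open>The projection onto the line of a nonzero vector \<open>w\<close> in the range of the
  adjoint of \<open>b\<close> works: \<open>w\<close> is orthogonal to the kernel of
  \<open>b\<close>, so \<open>b\<close> does not kill it. This choice of \<open>w\<close> also lets
  \<open>rank_one_compact\<close> supply the projection, with the adjoint as the compact
  operator.\<close>

lemma compact_cstar_algebra_separated:
  assumes "compact_cstar_algebra TYPE('b::cstar_algebra) TYPE('i) TYPE('h)"
  shows "separated_by_minimal_projections TYPE('b)"
  unfolding separated_by_minimal_projections_def
proof (intro allI impI)
  fix b :: 'b
  assume b: "b \<noteq> 0"
  obtain I :: "'i set" and H :: "'i \<Rightarrow> 'h hilbert_structure" and \<Phi> :: "'b \<Rightarrow> 'i \<Rightarrow> 'h \<Rightarrow> 'h"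
    where hilbert: "\<And>i. i \<in> I \<Longrightarrow> complex_hilbert_space (H i)"
      and iso: "cstar_isomorphism_c0_sum I H \<Phi>"
    using assms by (auto simp: compact_cstar_algebra_def)
  have bij: "bij_betw \<Phi> UNIV (c0_sum_compact_operators I H)"
    using iso by (simp add: cstar_isomorphism_c0_sum_def)
  have mem: "\<Phi> a \<in> c0_sum_compact_operators I H" for a
    using bij by (auto simp: bij_betw_def)
  have op: "\<Phi> a i \<in> compact_operators (H i)" if "i \<in> I" for a i
    using mem[of a] that by (auto simp: c0_sum_compact_operators_def)
  have closed: "\<Phi> a i x \<in> hcarrier (H i)" if "i \<in> I" "x \<in> hcarrier (H i)" for a i x
    using op[OF that(1), of a] that(2) by (auto simp: compact_operators_def)
  have linear: "\<Phi> a i (hscale (H i) c x) = hscale (H i) c (\<Phi> a i x)"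
    if "i \<in> I" "x \<in> hcarrier (H i)" for a i c x
    using op[OF that(1), of a] that(2) by (auto simp: compact_operators_def)
  have scale: "\<Phi> (scaleC c a) i x = hscale (H i) c (\<Phi> a i x)"
    and mult: "\<Phi> (a * a') i x = \<Phi> a i (\<Phi> a' i x)"
    and adj: "y \<in> hcarrier (H i) \<Longrightarrow> hinner (H i) (\<Phi> a i x) y = hinner (H i) x (\<Phi> (star a) i y)"
    if "i \<in> I" "x \<in> hcarrier (H i)" for c a a' i x y
    using iso that
    by (simp_all add: cstar_isomorphism_c0_sum_def op_scale_def compose_def is_adjoint_def)
  have zero: "\<Phi> 0 i x = hzero (H i)" if "i \<in> I" "x \<in> hcarrier (H i)" for i x
    using scale[OF that, of 0 0] complex_hilbert_space.scale_0[OF hilbert closed, OF that(1) that]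
    by simp
  have eqI: "a = a'" if "\<And>i x. i \<in> I \<Longrightarrow> x \<in> hcarrier (H i) \<Longrightarrow> \<Phi> a i x = \<Phi> a' i x" for a a'
  proof -
    have "\<Phi> a = \<Phi> a'"
    proof (rule PiE_ext)
      show "\<Phi> a \<in> (\<Pi>\<^sub>E i\<in>I. compact_operators (H i))" "\<Phi> a' \<in> (\<Pi>\<^sub>E i\<in>I. compact_operators (H i))"
        using mem by (auto simp: c0_sum_compact_operators_def)
      fix i assume i: "i \<in> I"
      show "\<Phi> a i = \<Phi> a' i"
        by (rule PiE_ext[of _ "hcarrier (H i)" "\<lambda>_. hcarrier (H i)"])
          (use op[OF i] that[OF i] in \<open>auto simp: compact_operators_def\<close>)
    qed
    then show ?thesis
      using bij by (auto simp: bij_betw_def inj_on_def)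
  qed
  have "star b \<noteq> 0"
    using b by (metis star_star star_zero)
  then obtain i v where i: "i \<in> I" and v: "v \<in> hcarrier (H i)" and "\<Phi> (star b) i v \<noteq> hzero (H i)"
    using eqI[of "star b" 0] zero by metis
  define w where "w = \<Phi> (star b) i v"
  interpret complex_hilbert_space "H i"
    by (rule hilbert[OF i])
  have w: "w \<in> hcarrier (H i)" "w \<noteq> hzero (H i)"
    unfolding w_def by (rule closed[OF i v]) fact
  define N where "N = hinner (H i) w w"
  have N: "N \<noteq> 0" "cnj N = N"
    using inner_eq_zero[OF w(1)] w(2) inner_self[OF w(1)] by (auto simp: N_def)
  \<comment> \<open>Shrinks \<open>w\<close> to meet the norm bound of
    \<open>rank_one_compact\<close>; the summand 1 keeps the denominator positive.\<close>
  define r where "r = 1 / (1 + hnorm (H i) w * hnorm (H i) v)"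
  have nonneg: "0 \<le> hnorm (H i) w * hnorm (H i) v"
    by (intro mult_nonneg_nonneg hnorm_nonneg w v)
  then have r: "0 < r" "r * (hnorm (H i) w * hnorm (H i) v) \<le> 1"
    by (auto simp: r_def field_simps)
  let ?u = "hscale (H i) (complex_of_real r) w"
  let ?R = "\<lambda>x\<in>hcarrier (H i). hscale (H i) (hinner (H i) x ?u) (\<Phi> (star b) i v)"
  have R: "?R \<in> compact_operators (H i)"
    by (rule rank_one_compact[OF op[OF i] _ v])
      (use r w in \<open>simp_all add: hnorm_scale scale_closed mult.assoc\<close>)
  \<comment> \<open>Changing the zero family in one coordinate enlarges each of the finite sets by
    at most \<open>i\<close>.\<close>
  have "(\<Phi> 0)(i := ?R) \<in> c0_sum_compact_operators I H"
  proof -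
    have "(\<Phi> 0)(i := ?R) \<in> (\<Pi>\<^sub>E i\<in>I. compact_operators (H i))"
      using mem[of 0] i R by (auto simp: c0_sum_compact_operators_def PiE_iff extensional_def)
    moreover have "finite {j \<in> I. \<epsilon> \<le> op_norm (H j) (((\<Phi> 0)(i := ?R)) j)}" if "\<epsilon> > 0" for \<epsilon>
    proof (rule finite_subset)
      show "{j \<in> I. \<epsilon> \<le> op_norm (H j) (((\<Phi> 0)(i := ?R)) j)} \<subseteq> insert i {j \<in> I. \<epsilon> \<le> op_norm (H j) (\<Phi> 0 j)}"
        by auto
      show "finite (insert i {j \<in> I. \<epsilon> \<le> op_norm (H j) (\<Phi> 0 j)})"
        using mem[of 0] that by (simp add: c0_sum_compact_operators_def)
    qed
    ultimately show ?thesis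
      by (simp add: c0_sum_compact_operators_def)
  qed
  then obtain g where g: "\<Phi> g = (\<Phi> 0)(i := ?R)"
    using bij by (metis (no_types, lifting) bij_betw_imp_surj_on imageE)
  \<comment> \<open>In coordinate \<open>i\<close>, \<open>g\<close> sends \<open>x\<close> to
    \<open>r * hinner (H i) x w\<close> times \<open>w\<close>; division by \<open>r * N\<close>
    gives the orthogonal projection onto the line of \<open>w\<close>.\<close>
  define e where "e = scaleC (1 / (r * N)) g"
  have ei: "\<Phi> e i x = hscale (H i) (hinner (H i) x w / N) w" if "x \<in> hcarrier (H i)" for x
    using that i w r(1) N
    by (simp add: e_def scale g inner_scale_right scale_scale flip: w_def)
  have ej: "\<Phi> e j x = hzero (H j)" if "j \<in> I" "j \<noteq> i" "x \<in> hcarrier (H j)" for j x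
    using that
    by (simp add: e_def scale g zero complex_hilbert_space.scale_hzero[OF hilbert])
  have zeroj: "\<Phi> a j (hzero (H j)) = hzero (H j)" if "j \<in> I" for a j
    using linear[OF that, of "hzero (H j)" a 0] closed[OF that] complex_hilbert_space.zero_closed[OF hilbert[OF that]]
      complex_hilbert_space.scale_0[OF hilbert[OF that]] by metis
  have zero_in: "hzero (H j) \<in> hcarrier (H j)" if "j \<in> I" for j
    by (rule complex_hilbert_space.zero_closed[OF hilbert[OF that]])
  have ew: "\<Phi> e i w = w"
    using ei[OF w(1)] N by (simp add: scale_one w flip: N_def)
  have "e \<noteq> 0"
    using ew zero[OF i w(1)] w(2) by metis
  moreover have "star e = e"
  proof (rule eqI)
    fix j x assume j: "j \<in> I" "x \<in> hcarrier (H j)"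
    have "hinner (H j) y (\<Phi> (star e) j x) = hinner (H j) y (\<Phi> e j x)" if y: "y \<in> hcarrier (H j)" for y
    proof (cases "j = i")
      case True
      have "hinner (H i) w x = cnj (hinner (H i) x w)"
        using j(2) w(1) unfolding True by (rule inner_commute)
      then show ?thesis
        using adj[OF j(1) y j(2), of e] y j w N True
        by (simp add: ei inner_scale_left inner_scale_right mult.commute)
    next
      case False
      interpret j: complex_hilbert_space "H j"
        by (rule hilbert[OF j(1)])
      have "hinner (H j) y (hzero (H j)) = 0"
        using j.inner_commute[OF j.zero_closed y] j.inner_zero_left[OF y] by simp
      then show ?thesis
        using adj[OF j(1) y j(2), of e] ej[OF j(1) False] j y j.inner_zero_left by simp
    qed
    then show "\<Phi> (star e) j x = \<Phi> e j x"
      by (rule complex_hilbert_space.inner_eqI[OF hilbert[OF j(1)] closed[OF j] closed[OF j]])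
  qed
  moreover have corner: "e * a * e = scaleC (hinner (H i) (\<Phi> a i w) w / N) e" for a
  proof (rule eqI)
    fix j x assume j: "j \<in> I" "x \<in> hcarrier (H j)"
    show "\<Phi> (e * a * e) j x = \<Phi> (scaleC (hinner (H i) (\<Phi> a i w) w / N) e) j x"
    proof (cases "j = i")
      case True
      then show ?thesis
        using j i w closed[OF i w(1), of a]
        by (simp add: mult scale closed ei linear scale_closed inner_scale_left scale_scale mult.commute)
    next
      case False
      then show ?thesis
        using j zero_in
        by (simp add: mult scale closed ej zeroj complex_hilbert_space.scale_hzero[OF hilbert])
    qed
  qed
  moreover have "e * e = e"
  proof (rule eqI)
    fix j x assume j: "j \<in> I" "x \<in> hcarrier (H j)"
    show "\<Phi> (e * e) j x = \<Phi> e j x"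
    proof (cases "j = i")
      case True
      then show ?thesis
        using j w by (simp add: mult ei[of x] linear ew)
    next
      case False
      then show ?thesis
        using j zero_in by (simp add: mult ej)
    qed
  qed
  moreover have "b * e \<noteq> 0"
  proof
    assume "b * e = 0"
    then have "\<Phi> b i w = hzero (H i)"
      using mult[OF i w(1), of b e] zero[OF i w(1)] by (simp add: ew)
    then have "hinner (H i) w w = 0"
      using adj[OF i w(1) v, of b] inner_zero_left[OF v] by (simp add: w_def)
    with N show False
      by (simp add: N_def)
  qed
  ultimately show "\<exists>e. minimal_projection e \<and> b * e \<noteq> 0"
    unfolding minimal_projection_def by blast
qed

theorem theorem2p15:
  fixes \<Delta> :: "('x::t2_space \<Rightarrow>\<^sub>C 'b::cstar_algebra) \<Rightarrow> ('x \<Rightarrow>\<^sub>C 'b)"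
  assumes "compact (UNIV :: 'x set)"
    and "compact_cstar_algebra TYPE('b) TYPE('i) TYPE('h)"
  shows "(weak_2_local_derivation \<Delta> \<longrightarrow> derivation \<Delta>) \<and>
         (two_local_derivation \<Delta> \<longrightarrow> derivation \<Delta>)"
proof -
  have "derivation \<Delta>" if "weak_2_local_derivation \<Delta>"
    using weak_2_local_derivation_imp_derivation compact_cstar_algebra_separated assms(2) that by blast
  moreover have "weak_2_local_derivation \<Delta>" if "two_local_derivation \<Delta>"
    using that unfolding two_local_derivation_def weak_2_local_derivation_def by metis
  ultimately show ?thesis by blast
qed

end
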